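(* Let $I$ be a nontrivial compact interval of $\mathbb{R}$ and let $f: I \to I$ be continuous. Then for all integers $m \ge 2$, $n \ge 2$, $k \ge 1$, $i \ge 0$ and $p \ge 1$, the following implications hold for $f$: (1) $L^k(m,n) \Rightarrow L^k(m,n+1)$ and $L^k(m,n) \Rightarrow L^k(m+1,n)$; (2) $L^k(m,n) \Rightarrow L^k(m,\infty) \Rightarrow L^k(m+1,\infty) \Rightarrow L^k(\infty,\infty) \Rightarrow L^k(\infty)$; (3) $S^{2^i}(3) \Rightarrow L^{2^{i+1}}(2,2)$; (4) $S^{2^i}(2n+1) \Rightarrow L^{2^{i+1}}(n,n+1)$; (5) $S^{2^i}(2p+1) \Rightarrow P(2^i\cdot(2p+3)) \Rightarrow S^{2^i}(2p+3)$.
   Context: For a continuous $f: I\to I$, the forward orbit of $x_0$ is $\{x_j = f^j(x_0): j\ge 0\}$; a backward orbit of $x_0$ is a sequence $\{x_{-j}: j \ge 0\}$ with $f(x_{-j}) = x_{-j+1}$ for all $j\ge1$. A point $x_0$ is a period-$N$ point of a map $g$ if $g^N(x_0)=x_0$ and $g^j(x_0)\ne x_0$ for $0<j<N$; a fixed point is a period-1 point. "Property $A \Rightarrow$ property $B$" means: if $f$ has property $A$ then $f$ has property $B$. Properties of $f$ (with $k, m, n, N$ positive integers): - $P(N)$: $f$ has a period-$N$ point. - $S^k(2n+1)$: $f^k$ has a period-$(2n+1)$ point $x_0$ whose forward orbit $\{x_j\}$ under $f^k$ satisfies $x_{2n} < x_{2n-2} < \cdots < x_2 < x_0 < x_1 <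 x_3 < \cdots < x_{2n-3} < x_{2n-1}$, or all these inequalities reversed. - $L^k(\infty)$: $f^k$ has a fixed point $x_0$ with a backward orbit $\{x_{-j}\}$ under $f^k$ satisfying $x_0 < \cdots < x_{-j} < x_{-j+1} < \cdots < x_{-2} < x_{-1}$, or all inequalities reversed. - $L^k(m,n)$: $f^k$ has a period-$(m+n)$ point $x_0$ whose forward orbit $\{x_j\}$ under $f^k$ satisfies $x_{m+n-1} < \cdots < x_{n+1} < x_n < x_0 < x_1 < x_2 < \cdots < x_{n-1}$, or all inequalities reversed. - $L^k(m,\infty)$: $f^k$ has a fixed point $x_0$ with a backward orbit $\{x_{-j}\}$ under $f^k$ satisfying $x_{-1} < x_{-2} < \cdots < x_{-m} < x_0 < \cdots < x_{-j} < x_{-j+1} < \cdots < x_{-m-1}$ (i.e. $x_{-1},\dots,x_{-m}$ increase toward $x_0$ from the left, and the points $x_{-j}$, $j \ge m+1$, lie to the right of $x_0$ and decrease toward $x_0$ as $j$ increases), or all inequalities reversed. - $L^k(\infty,\infty)$: $f^k$ has a fixed point $x_0=y_0$ with two backward orbits $\{x_{-j}\}$ and $\{y_{-j}\}$ under $f^k$ satisfying $x_{-1} < \cdots < x_{-j+1} < x_{-j} < \cdots < x_0 = y_0 < \cdots < y_{-j} < y_{-j+1} < \cdots < y_{-1}$, or all inequalities reversed. *)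

theory Defs
  imports "HOL-Analysis.Analysis"
begin

text \<open>Throughout, the interval is I = {a..b} and f is viewed as a self-map of I.
  The orbit of x0 under g = f^^k is j \<mapsto> (g^^j) x0.
  A backward orbit of x0 under g is a sequence xb :: nat \<Rightarrow> real in I with
  xb 0 = x0 and g (xb (Suc j)) = xb j, where xb j stands for x_{-j}.
  Each ordering predicate takes a strict relation lt, instantiated with (<)
  or with (>) to express "all inequalities reversed".\<close>

definition per_pt :: "(real \<Rightarrow> real) \<Rightarrow> nat \<Rightarrow> real \<Rightarrow> bool" where
  "per_pt g N x \<longleftrightarrow> (g ^^ N) x = x \<and> (\<forall>j. 0 < j \<and> j < N \<longrightarrow> (g ^^ j) x \<noteq> x)"

definition back_orbit :: "real \<Rightarrow> real \<Rightarrow> (real \<Rightarrow> real) \<Rightarrow> real \<Rightarrow> (nat \<Rightarrow> real) \<Rightarrow> bool" where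
  "back_orbit a b g x0 xb \<longleftrightarrow> xb 0 = x0 \<and> (\<forall>j. xb j \<in> {a..b}) \<and> (\<forall>j. g (xb (Suc j)) = xb j)"

definition P_prop :: "(real \<Rightarrow> real) \<Rightarrow> real \<Rightarrow> real \<Rightarrow> nat \<Rightarrow> bool" where
  "P_prop f a b N \<longleftrightarrow> (\<exists>x0\<in>{a..b}. per_pt f N x0)"

definition S_order :: "(real \<Rightarrow> real \<Rightarrow> bool) \<Rightarrow> (nat \<Rightarrow> real) \<Rightarrow> nat \<Rightarrow> bool" where
  "S_order lt x n \<longleftrightarrow> (\<forall>j. j < n \<longrightarrow> lt (x (2*j+2)) (x (2*j)))
      \<and> lt (x 0) (x 1) \<and> (\<forall>j. j + 1 < n \<longrightarrow> lt (x (2*j+1)) (x (2*j+3)))"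

definition S_prop :: "(real \<Rightarrow> real) \<Rightarrow> real \<Rightarrow> real \<Rightarrow> nat \<Rightarrow> nat \<Rightarrow> bool" where
  "S_prop f a b k n \<longleftrightarrow> (\<exists>x0\<in>{a..b}. per_pt (f ^^ k) (2*n+1) x0 \<and>
      (S_order (<) (\<lambda>j. ((f ^^ k) ^^ j) x0) n \<or> S_order (>) (\<lambda>j. ((f ^^ k) ^^ j) x0) n))"

definition Linf_order :: "(real \<Rightarrow> real \<Rightarrow> bool) \<Rightarrow> (nat \<Rightarrow> real) \<Rightarrow> bool" where
  "Linf_order lt xb \<longleftrightarrow> (\<forall>j\<ge>1. lt (xb 0) (xb j) \<and> lt (xb (Suc j)) (xb j))"

definition Linf_prop :: "(real \<Rightarrow> real) \<Rightarrow> real \<Rightarrow> real \<Rightarrow> nat \<Rightarrow> bool" where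
  "Linf_prop f a b k \<longleftrightarrow> (\<exists>x0\<in>{a..b}. \<exists>xb. (f ^^ k) x0 = x0 \<and>
      back_orbit a b (f ^^ k) x0 xb \<and> (Linf_order (<) xb \<or> Linf_order (>) xb))"

definition Lmn_order :: "(real \<Rightarrow> real \<Rightarrow> bool) \<Rightarrow> (nat \<Rightarrow> real) \<Rightarrow> nat \<Rightarrow> nat \<Rightarrow> bool" where
  "Lmn_order lt x m n \<longleftrightarrow> (\<forall>j. j + 1 < n \<longrightarrow> lt (x j) (x (j+1)))
      \<and> lt (x n) (x 0) \<and> (\<forall>j. n \<le> j \<and> j + 1 < m + n \<longrightarrow> lt (x (j+1)) (x j))"

definition Lmn_prop :: "(real \<Rightarrow> real) \<Rightarrow> real \<Rightarrow> real \<Rightarrow> nat \<Rightarrow> nat \<Rightarrow> nat \<Rightarrow> bool" where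
  "Lmn_prop f a b k m n \<longleftrightarrow> (\<exists>x0\<in>{a..b}. per_pt (f ^^ k) (m+n) x0 \<and>
      (Lmn_order (<) (\<lambda>j. ((f ^^ k) ^^ j) x0) m n \<or> Lmn_order (>) (\<lambda>j. ((f ^^ k) ^^ j) x0) m n))"

definition Lminf_order :: "(real \<Rightarrow> real \<Rightarrow> bool) \<Rightarrow> (nat \<Rightarrow> real) \<Rightarrow> nat \<Rightarrow> bool" where
  "Lminf_order lt xb m \<longleftrightarrow> (\<forall>j. 1 \<le> j \<and> j < m \<longrightarrow> lt (xb j) (xb (Suc j)))
      \<and> lt (xb m) (xb 0)
      \<and> (\<forall>j\<ge>m+1. lt (xb 0) (xb j) \<and> lt (xb (Suc j)) (xb j))"

definition Lminf_prop :: "(real \<Rightarrow> real) \<Rightarrow> real \<Rightarrow> real \<Rightarrow> nat \<Rightarrow> nat \<Rightarrow> bool" where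
  "Lminf_prop f a b k m \<longleftrightarrow> (\<exists>x0\<in>{a..b}. \<exists>xb. (f ^^ k) x0 = x0 \<and>
      back_orbit a b (f ^^ k) x0 xb \<and> (Lminf_order (<) xb m \<or> Lminf_order (>) xb m))"

definition Linfinf_order :: "(real \<Rightarrow> real \<Rightarrow> bool) \<Rightarrow> (nat \<Rightarrow> real) \<Rightarrow> (nat \<Rightarrow> real) \<Rightarrow> bool" where
  "Linfinf_order lt xb yb \<longleftrightarrow> (\<forall>j\<ge>1. lt (xb j) (xb (Suc j)) \<and> lt (xb j) (xb 0)
      \<and> lt (yb 0) (yb j) \<and> lt (yb (Suc j)) (yb j))"

definition Linfinf_prop :: "(real \<Rightarrow> real) \<Rightarrow> real \<Rightarrow> real \<Rightarrow> nat \<Rightarrow> bool" where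
  "Linfinf_prop f a b k \<longleftrightarrow> (\<exists>x0\<in>{a..b}. \<exists>xb yb. (f ^^ k) x0 = x0 \<and>
      back_orbit a b (f ^^ k) x0 xb \<and> back_orbit a b (f ^^ k) x0 yb \<and>
      (Linfinf_order (<) xb yb \<or> Linfinf_order (>) xb yb))"

end

theory Submission
  imports Defs
begin

text \<open>
  Everything rests on loops of intervals: if compact intervals cover one another cyclically under
  \<open>g\<close>, some periodic point follows the loop, and when consecutive intervals meet at most in
  endpoints its orbit inherits the order of the intervals. Cycles of L- and S-type provide such
  loops, and a fixed point \<open>z\<close> in the middle gap together with preimages of the orbit
  points near \<open>z\<close> lengthens them. Backward orbits arise likewise by iterated use of
  the intermediate value theorem.

  An orbit of odd period \<open>q\<close> cannot be split by \<open>z\<close> into two halves that \<open>g\<close>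
  exchanges. Spiralling outwards from \<open>z\<close> through outermost images, one meets an orbit point
  that stays on its side of \<open>z\<close>; this closes a loop of some odd length at most \<open>q\<close>, hence
  yields a Stefan cycle of that period, and the length can then be raised in steps of 2.
\<close>

text \<open>Coverings alone give weak inequalities, since neighbouring intervals may share
  endpoints. In the loops that yield L- and S-cycles, strictness is recovered from the dynamics: a
  coincidence of neighbouring points would put a fixed point on the cycle and thus make the whole
  cycle constant, which some strict separation along the loop excludes.

  All constructions are made for \<open>(<)\<close> only and are carried over to \<open>(>)\<close>
  by conjugation with negation; this is why the order relation is a parameter throughout.

  The two halves cannot be exchanged because \<open>g\<close> permutes a periodic orbit, so that
  they would have equally many points. For the implication between odd periods it is not enough to
  find some odd loop: its length must not exceed the given period, because cycles can be lengthened
  but not shortened. Hence the orbit points met before the loop closes have to be counted.\<close>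

section \<open>Coverings and itineraries\<close>

text \<open>Two points whose images enclose the target certify a covering, so that coverings can be
  checked without continuity; it enters only when preimages are extracted.\<close>

definition covers :: "(real \<Rightarrow> real) \<Rightarrow> real set \<Rightarrow> real set \<Rightarrow> bool" where
  "covers g S T \<longleftrightarrow> (\<exists>s\<in>S. \<exists>t\<in>S. T \<subseteq> closed_segment (g s) (g t))"

lemma coversI:
  assumes "s \<in> S" "t \<in> S" "T \<subseteq> closed_segment (g s) (g t)"
  shows "covers g S T"
  using assms unfolding covers_def by blast

lemma covers_ivl:
  fixes u v p q :: real
  assumes "s \<in> closed_segment u v" "t \<in> closed_segment u v"
    and "g s \<le> p" "g s \<le> q" "p \<le> g t" "q \<le> g t"
  shows "covers g (closed_segment u v) (closed_segment p q)"
  by (rule coversI[OF assms(1,2)]) (use assms(3-) in \<open>auto simp: closed_segment_eq_real_ivl split: if_splits\<close>)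

lemma segment_memD:
  fixes x :: real
  assumes "x \<in> closed_segment u v" "u \<le> v"
  shows "u \<le> x" "x \<le> v"
  using assms by (auto simp: closed_segment_eq_real_ivl)

lemma segment_subset_ivl:
  fixes u v :: real
  assumes "u \<in> {a..b}" "v \<in> {a..b}"
  shows "closed_segment u v \<subseteq> {a..b}"
  using assms by (auto simp: closed_segment_eq_real_ivl)

text \<open>Take \<open>t\<close> as the first point with value \<open>d\<close>, then
  \<open>s\<close> as the last point before \<open>t\<close> with value \<open>c\<close>. By the
  intermediate value theorem an excursion above \<open>d\<close> or below \<open>c\<close> between
  them would contradict one of these choices.\<close>

lemma tight_preimage_ordered:
  fixes g :: "real \<Rightarrow> real"
  assumes "continuous_on {s0..t0} g" "s0 \<le> t0" "g s0 \<le> c" "d \<le> g t0" "c \<le> d"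
  shows "\<exists>s t. s0 \<le> s \<and> s \<le> t \<and> t \<le> t0 \<and> g s = c \<and> g t = d \<and> (\<forall>x\<in>{s..t}. g x \<in> {c..d})"
proof -
  let ?T = "{s0..t0} \<inter> g -` {d}"
  have "compact ?T"
    using assms(1) by (simp add: compact_eq_bounded_closed continuous_closed_preimage bounded_Int)
  moreover have "?T \<noteq> {}"
    using IVT'[of g s0 d t0] assms by auto
  ultimately obtain t where t: "t \<in> ?T" "\<And>x. x \<in> ?T \<Longrightarrow> t \<le> x"
    using compact_attains_inf by metis
  have less: "g x \<le> d" if x: "s0 \<le> x" "x \<le> t" for x
  proof (rule ccontr)
    assume "\<not> g x \<le> d"
    moreover have "continuous_on {s0..x} g"
      by (rule continuous_on_subset[OF assms(1)]) (use t that in auto)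
    ultimately obtain y where "s0 \<le> y" "y \<le> x" "g y = d"
      using IVT'[of g s0 d x] assms x by auto
    moreover from this have "t \<le> y" using t x by auto
    ultimately have "y = x" using x by linarith
    then show False using \<open>g y = d\<close> \<open>\<not> g x \<le> d\<close> by simp
  qed
  let ?S = "{s0..t} \<inter> g -` {c}"
  have ct: "continuous_on {s0..t} g"
    by (rule continuous_on_subset[OF assms(1)]) (use t in auto)
  then have "compact ?S"
    by (simp add: compact_eq_bounded_closed continuous_closed_preimage bounded_Int)
  moreover have "?S \<noteq> {}"
    using IVT'[of g s0 c t] assms ct t by auto
  ultimately obtain s where s: "s \<in> ?S" "\<And>x. x \<in> ?S \<Longrightarrow> x \<le> s"
    using compact_attains_sup by metis
  have gr: "c \<le> g x" if x: "s \<le> x" "x \<le> t" for x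
  proof (rule ccontr)
    assume "\<not> c \<le> g x"
    moreover have "continuous_on {x..t} g"
      by (rule continuous_on_subset[OF ct]) (use s that in auto)
    ultimately obtain y where "x \<le> y" "y \<le> t" "g y = c"
      using IVT'[of g x c t] assms x t by auto
    moreover from this have "y \<le> s" using s x by auto
    ultimately have "y = x" using x by linarith
    then show False using \<open>g y = c\<close> \<open>\<not> c \<le> g x\<close> by simp
  qed
  show ?thesis
    using s(1) t(1) less gr by (intro exI[of _ s] exI[of _ t]) auto
qed

lemma tight_preimage_le:
  fixes g :: "real \<Rightarrow> real"
  assumes cont: "continuous_on {a..b} g" and "s0 \<in> {a..b}" "t0 \<in> {a..b}" "g s0 \<le> c" "d \<le> g t0" "c \<le> d"
  shows "\<exists>s\<in>closed_segment s0 t0. \<exists>t\<in>closed_segment s0 t0. g s = c \<and> g t = d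
    \<and> (\<forall>x\<in>closed_segment s t. g x \<in> {c..d})"
proof (cases "s0 \<le> t0")
  case True
  have "continuous_on {s0..t0} g"
    by (rule continuous_on_subset[OF cont]) (use assms in auto)
  from tight_preimage_ordered[OF this True assms(4-6)] show ?thesis
    using True by (fastforce simp: closed_segment_eq_real_ivl)
next
  case False
  \<comment> \<open>Mirroring the domain, with values unchanged, reduces a descending pair to the
    ordered case.\<close>
  let ?h = "\<lambda>x. g (- x)"
  have "continuous_on {-s0..-t0} ?h"
    by (rule continuous_on_compose2[OF cont]) (use assms in \<open>auto intro!: continuous_intros\<close>)
  from tight_preimage_ordered[OF this, of c d] obtain s t where st:
    "- s0 \<le> s" "s \<le> t" "t \<le> - t0" "g (- s) = c" "g (- t) = d" "\<forall>x\<in>{s..t}. g (- x) \<in> {c..d}"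
    using False assms by auto
  have "g x \<in> {c..d}" if "- t \<le> x" "x \<le> - s" for x
    using st(6)[rule_format, of "- x"] that by auto
  then show ?thesis
    using st False by (intro bexI[of _ "-s"] bexI[of _ "-t"]) (auto simp: closed_segment_eq_real_ivl)
qed

lemma closed_segment_min_max: "closed_segment p q = {min p q..max p q}" for p q :: real
  by (simp add: closed_segment_eq_real_ivl)

text \<open>The endpoints keep their roles: \<open>s\<close> goes to \<open>p\<close> and
  \<open>t\<close> to \<open>q\<close>, whichever is larger. This orientation is what allows
  iteration along a path of segments.\<close>

lemma tight_preimage:
  fixes g :: "real \<Rightarrow> real"
  assumes cont: "continuous_on {a..b} g" and "closed_segment u v \<subseteq> {a..b}"
    and "covers g (closed_segment u v) (closed_segment p q)"
  shows "\<exists>s\<in>closed_segment u v. \<exists>t\<in>closed_segment u v. g s = p \<and> g t = q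
    \<and> (\<forall>x\<in>closed_segment s t. g x \<in> closed_segment p q)"
proof -
  obtain s0 t0 where st: "s0 \<in> closed_segment u v" "t0 \<in> closed_segment u v"
    "closed_segment p q \<subseteq> closed_segment (g s0) (g t0)"
    using assms(3) unfolding covers_def by auto
  have "p \<in> closed_segment (g s0) (g t0)" "q \<in> closed_segment (g s0) (g t0)"
    using st(3) by auto
  then have "min (g s0) (g t0) \<le> min p q" "max p q \<le> max (g s0) (g t0)"
    by (simp_all add: closed_segment_min_max)
  then obtain s1 t1 where st1: "s1 \<in> closed_segment u v" "t1 \<in> closed_segment u v"
    "g s1 \<le> min p q" "max p q \<le> g t1"
    using st(1,2) by (metis max_def min_def)
  have sub: "closed_segment s1 t1 \<subseteq> closed_segment u v"
    using st1 by (simp add: closed_segment_subset)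
  have "min p q \<le> max p q" by simp
  then obtain s t where 1: "s\<in>closed_segment s1 t1" "t\<in>closed_segment s1 t1"
     "g s = min p q" "g t = max p q" "\<forall>x\<in>closed_segment s t. g x \<in> {min p q..max p q}"
    using tight_preimage_le[OF cont _ _ st1(3,4)] st1(1,2) assms(2) by blast
  show ?thesis
  proof (cases "p \<le> q")
    case True
    then show ?thesis using 1 sub unfolding closed_segment_min_max[of p q]
      by (intro bexI[of _ s] bexI[of _ t]) auto
  next
    case False
    then show ?thesis using 1 sub unfolding closed_segment_min_max[of p q]
      by (intro bexI[of _ t] bexI[of _ s]) (auto simp: closed_segment_commute[of t s])
  qed
qed

text \<open>The piece found for the remaining path is pulled back into the first segment. As
  endpoints go to endpoints, the last iterate sends the ends of the piece to the ends of the final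
  segment, ready for a sign change argument on closed loops.\<close>

lemma itinerary:
  fixes g :: "real \<Rightarrow> real" and u v :: "nat \<Rightarrow> real"
  assumes cont: "continuous_on {a..b} g"
    and "\<And>j. j \<le> N \<Longrightarrow> closed_segment (u j) (v j) \<subseteq> {a..b}"
    and "\<And>j. j < N \<Longrightarrow> covers g (closed_segment (u j) (v j)) (closed_segment (u (Suc j)) (v (Suc j)))"
  shows "\<exists>s\<in>closed_segment (u 0) (v 0). \<exists>t\<in>closed_segment (u 0) (v 0).
    (g ^^ N) s = u N \<and> (g ^^ N) t = v N
    \<and> (\<forall>x\<in>closed_segment s t. \<forall>j\<le>N. (g ^^ j) x \<in> closed_segment (u j) (v j))"
  using assms(2,3)
proof (induction N arbitrary: u v)
  case 0
  show ?case by (intro bexI[of _ "u 0"] bexI[of _ "v 0"]) auto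
next
  case (Suc N)
  obtain s' t' where st': "s'\<in>closed_segment (u 1) (v 1)" "t'\<in>closed_segment (u 1) (v 1)"
    "(g ^^ N) s' = u (Suc N)" "(g ^^ N) t' = v (Suc N)"
    "\<And>x j. x \<in> closed_segment s' t' \<Longrightarrow> j \<le> N \<Longrightarrow> (g ^^ j) x \<in> closed_segment (u (Suc j)) (v (Suc j))"
    using Suc.IH[of "\<lambda>j. u (Suc j)" "\<lambda>j. v (Suc j)"] Suc.prems by auto
  have "closed_segment s' t' \<subseteq> closed_segment (u 1) (v 1)"
    using st'(1,2) by (simp add: closed_segment_subset)
  then have "covers g (closed_segment (u 0) (v 0)) (closed_segment s' t')"
    using Suc.prems(2)[of 0] unfolding covers_def by fastforce
  from tight_preimage[OF cont Suc.prems(1)[of 0] this] obtain s t where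
    st: "s\<in>closed_segment (u 0) (v 0)" "t\<in>closed_segment (u 0) (v 0)" "g s = s'" "g t = t'"
    "\<And>x. x\<in>closed_segment s t \<Longrightarrow> g x \<in> closed_segment s' t'"
    by auto
  have "(g ^^ j) x \<in> closed_segment (u j) (v j)" if "x \<in> closed_segment s t" "j \<le> Suc N" for x j
  proof (cases j)
    case 0
    then show ?thesis using that st(1,2) closed_segment_subset[of s "closed_segment (u 0) (v 0)" t] by auto
  next
    case (Suc i)
    then show ?thesis using st'(5)[OF st(5)[OF that(1)], of i] that
      by (simp add: funpow_Suc_right del: funpow.simps)
  qed
  then show ?case using st st'
    by (intro bexI[of _ s] bexI[of _ t]) (auto simp: funpow_Suc_right simp del: funpow.simps)
qed

section \<open>Self-maps of a compact interval and periodic points following closed loops\<close>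

locale interval_map =
  fixes a b :: real and g :: "real \<Rightarrow> real"
  assumes cont: "continuous_on {a..b} g" and maps: "g ` {a..b} \<subseteq> {a..b}"
begin

lemma iter_in: "x \<in> {a..b} \<Longrightarrow> (g ^^ j) x \<in> {a..b}"
  using maps by (induction j) (auto simp del: atLeastAtMost_iff)

lemma cont_iter: "continuous_on {a..b} (g ^^ j)"
proof (induction j)
  case (Suc j)
  have "(g ^^ j) ` {a..b} \<subseteq> {a..b}" using iter_in by auto
  with Suc show ?case
    by (auto intro: continuous_on_compose continuous_on_subset[OF cont] simp del: o_apply)
qed (simp add: id_def)

lemma interval_map_iter: "interval_map a b (g ^^ j)"
  by unfold_locales (use cont_iter iter_in in auto)

text \<open>Strict inequalities at both ends keep the solution off the endpoints, so auxiliary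
  points created this way differ from the orbit points around them.\<close>

lemma ivt_open:
  assumes "u < v" "u \<in> {a..b}" "v \<in> {a..b}" "g u < y \<and> y < g v \<or> g v < y \<and> y < g u"
  obtains x where "u < x" "x < v" "g x = y" "x \<in> {a..b}"
proof -
  have c: "continuous_on {u..v} g"
    by (rule continuous_on_subset[OF cont]) (use assms in auto)
  have "\<exists>x. u \<le> x \<and> x \<le> v \<and> g x = y"
    using assms(1,4) IVT'[OF _ _ _ c, of y] IVT2'[OF _ _ _ c, of y] by auto
  then obtain x where x: "u \<le> x" "x \<le> v" "g x = y" by auto
  moreover have "x \<noteq> u" "x \<noteq> v" using x assms by auto
  ultimately show ?thesis using that[of x] assms(2,3) by auto
qed

lemma fixpoint_open:
  assumes "u < v" "u \<in> {a..b}" "v \<in> {a..b}" "g u < u \<and> v < g v \<or> g v < v \<and> u < g u"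
  obtains x where "u < x" "x < v" "g x = x" "x \<in> {a..b}"
proof -
  have c: "continuous_on {u..v} (\<lambda>x. g x - x)"
    by (intro continuous_intros continuous_on_subset[OF cont]) (use assms in auto)
  have "\<exists>x. u \<le> x \<and> x \<le> v \<and> g x - x = 0"
    using assms(1,4) IVT'[OF _ _ _ c, of 0] IVT2'[OF _ _ _ c, of 0] by auto
  then obtain x where x: "u \<le> x" "x \<le> v" "g x = x" by auto
  moreover have "x \<noteq> u" "x \<noteq> v" using x assms by auto
  ultimately show ?thesis using that[of x] assms(2,3) by auto
qed

lemma loop:
  fixes u v :: "nat \<Rightarrow> real"
  assumes sub: "\<And>j. j \<le> M \<Longrightarrow> u j \<in> {a..b} \<and> v j \<in> {a..b}"
    and step: "\<And>j. j < M \<Longrightarrow> covers g (closed_segment (u j) (v j)) (closed_segment (u (Suc j)) (v (Suc j)))"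
    and last: "covers g (closed_segment (u M) (v M)) (closed_segment (u 0) (v 0))"
  obtains x where "x \<in> {a..b}" "(g ^^ Suc M) x = x" "\<And>j. j \<le> M \<Longrightarrow> (g ^^ j) x \<in> closed_segment (u j) (v j)"
proof -
  \<comment> \<open>The first segment is appended again at index \<open>Suc M\<close>: the loop
    becomes a path that ends where it starts.\<close>
  define u' v' where "u' j = (if j \<le> M then u j else u 0)" and "v' j = (if j \<le> M then v j else v 0)" for j
  have "\<exists>s\<in>closed_segment (u' 0) (v' 0). \<exists>t\<in>closed_segment (u' 0) (v' 0).
    (g ^^ Suc M) s = u' (Suc M) \<and> (g ^^ Suc M) t = v' (Suc M)
    \<and> (\<forall>x\<in>closed_segment s t. \<forall>j\<le>Suc M. (g ^^ j) x \<in> closed_segment (u' j) (v' j))"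
  proof (rule itinerary[OF cont])
    show "closed_segment (u' j) (v' j) \<subseteq> {a..b}" for j
      using sub unfolding u'_def v'_def by (intro segment_subset_ivl) auto
    show "covers g (closed_segment (u' j) (v' j)) (closed_segment (u' (Suc j)) (v' (Suc j)))"
      if "j < Suc M" for j
    proof (cases "j < M")
      case True then show ?thesis using step by (simp add: u'_def v'_def)
    next
      case False
      then have "j = M" using that by simp
      then show ?thesis using last by (simp add: u'_def v'_def)
    qed
  qed
  then obtain s t where st': "s\<in>closed_segment (u' 0) (v' 0)" "t\<in>closed_segment (u' 0) (v' 0)"
    "(g ^^ Suc M) s = u' (Suc M)" "(g ^^ Suc M) t = v' (Suc M)"
    and it': "\<forall>x\<in>closed_segment s t. \<forall>j\<le>Suc M. (g ^^ j) x \<in> closed_segment (u' j) (v' j)"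
    by blast
  have st: "s\<in>closed_segment (u 0) (v 0)" "t\<in>closed_segment (u 0) (v 0)"
    "(g ^^ Suc M) s = u 0" "(g ^^ Suc M) t = v 0"
    using st' by (simp_all add: u'_def v'_def)
  have it: "(g ^^ j) x \<in> closed_segment (u j) (v j)" if "x\<in>closed_segment s t" "j \<le> M" for x j
    using it'[rule_format, of x j] that by (simp add: u'_def v'_def)
  have sub0: "closed_segment (u 0) (v 0) \<subseteq> {a..b}"
    using sub by (intro segment_subset_ivl) auto
  then have subst: "closed_segment s t \<subseteq> {a..b}"
    using st(1,2) by (intro segment_subset_ivl) auto
  let ?h = "\<lambda>x. (g ^^ Suc M) x - x"
  have c: "continuous_on (closed_segment s t) ?h"
    by (intro continuous_intros continuous_on_subset[OF cont_iter subst])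
  have "is_interval (?h ` closed_segment s t)"
    by (simp only: is_interval_connected_1 connected_continuous_image[OF c connected_segment(1)])
  moreover have "?h s \<in> ?h ` closed_segment s t" "?h t \<in> ?h ` closed_segment s t" by auto
  \<comment> \<open>Both \<open>s\<close> and \<open>t\<close> lie in the segment whose ends are
    their images under the iterate, so the displacement has opposite weak signs at them, whichever
    way the segment is oriented.\<close>
  moreover have "?h s \<le> 0 \<and> 0 \<le> ?h t \<or> ?h t \<le> 0 \<and> 0 \<le> ?h s"
    unfolding st(3,4) using st(1,2) by (auto simp: closed_segment_min_max min_def max_def split: if_splits)
  ultimately have "0 \<in> ?h ` closed_segment s t"
    unfolding is_interval_1 by blast
  then obtain x where "x \<in> closed_segment s t" "(g ^^ Suc M) x = x"
    by (auto simp del: funpow.simps)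
  with subst it show ?thesis by (intro that[of x]) auto
qed

end

section \<open>Reversing all inequalities\<close>

text \<open>The conjugate of \<open>g\<close> by negation, a self-map of the mirrored
  interval.\<close>

definition reflect :: "(real \<Rightarrow> real) \<Rightarrow> real \<Rightarrow> real" where
  "reflect g x = - g (- x)"

lemma reflect_reflect [simp]: "reflect (reflect g) = g"
  by (simp add: reflect_def fun_eq_iff)

lemma reflect_funpow: "(reflect g ^^ j) x = - ((g ^^ j) (- x))"
  by (induction j) (simp_all add: reflect_def)

lemma per_pt_reflect: "per_pt (reflect g) N x \<longleftrightarrow> per_pt g N (- x)"
proof -
  have "- u = x \<longleftrightarrow> u = - x" for u by auto
  then show ?thesis by (simp add: per_pt_def reflect_funpow)
qed

lemma interval_map_reflect:
  assumes "interval_map a b g"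
  shows "interval_map (- b) (- a) (reflect g)"
proof
  interpret interval_map a b g by fact
  show "continuous_on {- b..- a} (reflect g)"
    unfolding reflect_def
    by (intro continuous_intros continuous_on_compose2[OF cont]) auto
  have "reflect g x \<in> {- b..- a}" if "x \<in> {- b..- a}" for x
    using iter_in[of "- x" 1] that by (auto simp: reflect_def)
  then show "reflect g ` {- b..- a} \<subseteq> {- b..- a}" by auto
qed

lemma bex_reflect: "(\<exists>x\<in>{- b..- a}. Q (- x)) \<longleftrightarrow> (\<exists>x\<in>{a..b}. Q x)" for a b :: real
  by (metis (no_types, opaque_lifting) atLeastAtMost_iff minus_minus neg_le_iff_le)

lemma back_orbit_reflect:
  "back_orbit (- b) (- a) (reflect g) (- x) (\<lambda>j. - xb j) \<longleftrightarrow> back_orbit a b g x xb"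
  by (auto simp: back_orbit_def reflect_def)

text \<open>A fixed orientation and an arbitrary map \<open>g\<close> in place of
  \<open>f ^^ k\<close>, so that results can also be applied to
  \<open>reflect (f ^^ k)\<close>.\<close>

definition Lmn_on :: "(real \<Rightarrow> real \<Rightarrow> bool) \<Rightarrow> real \<Rightarrow> real \<Rightarrow> (real \<Rightarrow> real) \<Rightarrow> nat \<Rightarrow> nat \<Rightarrow> bool" where
  "Lmn_on lt a b g m n \<longleftrightarrow>
    (\<exists>x\<in>{a..b}. per_pt g (m+n) x \<and> Lmn_order lt (\<lambda>j. (g ^^ j) x) m n)"

definition Lminf_on :: "(real \<Rightarrow> real \<Rightarrow> bool) \<Rightarrow> real \<Rightarrow> real \<Rightarrow> (real \<Rightarrow> real) \<Rightarrow> nat \<Rightarrow> bool" where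
  "Lminf_on lt a b g m \<longleftrightarrow>
    (\<exists>x\<in>{a..b}. g x = x \<and> (\<exists>xb. back_orbit a b g x xb \<and> Lminf_order lt xb m))"

definition Linfinf_on :: "(real \<Rightarrow> real \<Rightarrow> bool) \<Rightarrow> real \<Rightarrow> real \<Rightarrow> (real \<Rightarrow> real) \<Rightarrow> bool" where
  "Linfinf_on lt a b g \<longleftrightarrow>
    (\<exists>x\<in>{a..b}. g x = x \<and>
      (\<exists>xb yb. back_orbit a b g x xb \<and> back_orbit a b g x yb \<and> Linfinf_order lt xb yb))"

definition S_on :: "(real \<Rightarrow> real \<Rightarrow> bool) \<Rightarrow> real \<Rightarrow> real \<Rightarrow> (real \<Rightarrow> real) \<Rightarrow> nat \<Rightarrow> bool" where
  "S_on lt a b g n \<longleftrightarrow>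
    (\<exists>x\<in>{a..b}. per_pt g (2*n+1) x \<and> S_order lt (\<lambda>j. (g ^^ j) x) n)"

lemma prop_iff_on:
  "Lmn_prop f a b k m n \<longleftrightarrow> Lmn_on (<) a b (f ^^ k) m n \<or> Lmn_on (>) a b (f ^^ k) m n"
  "Lminf_prop f a b k m \<longleftrightarrow> Lminf_on (<) a b (f ^^ k) m \<or> Lminf_on (>) a b (f ^^ k) m"
  "Linfinf_prop f a b k \<longleftrightarrow> Linfinf_on (<) a b (f ^^ k) \<or> Linfinf_on (>) a b (f ^^ k)"
  "S_prop f a b k n \<longleftrightarrow> S_on (<) a b (f ^^ k) n \<or> S_on (>) a b (f ^^ k) n"
  unfolding Lmn_prop_def Lmn_on_def Lminf_prop_def Lminf_on_def Linfinf_prop_def Linfinf_on_def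
    S_prop_def S_on_def by blast+

lemma order_reflect:
  "Lmn_order (>) x m n \<longleftrightarrow> Lmn_order (<) (\<lambda>j. - x j) m n"
  "Lminf_order (>) x m \<longleftrightarrow> Lminf_order (<) (\<lambda>j. - x j) m"
  "Linfinf_order (>) x y \<longleftrightarrow> Linfinf_order (<) (\<lambda>j. - x j) (\<lambda>j. - y j)"
  "S_order (>) x n \<longleftrightarrow> S_order (<) (\<lambda>j. - x j) n"
  by (simp_all add: Lmn_order_def Lminf_order_def Linfinf_order_def S_order_def)

lemma ex_uminus_fun: "(\<exists>xb. Q (\<lambda>j. - xb j)) \<longleftrightarrow> (\<exists>xb. Q xb)" for Q :: "(nat \<Rightarrow> real) \<Rightarrow> bool"
  by (metis (no_types, lifting) ext minus_minus)

lemma Lmn_on_reflect: "Lmn_on (>) a b g m n \<longleftrightarrow> Lmn_on (<) (- b) (- a) (reflect g) m n"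
  unfolding Lmn_on_def per_pt_reflect reflect_funpow order_reflect
  by (rule bex_reflect[symmetric])

lemma S_on_reflect: "S_on (>) a b g n \<longleftrightarrow> S_on (<) (- b) (- a) (reflect g) n"
  unfolding S_on_def per_pt_reflect reflect_funpow order_reflect
  by (rule bex_reflect[symmetric])

lemma reflect_fixpoint: "reflect g x = x \<longleftrightarrow> g (- x) = - x"
  by (auto simp: reflect_def)

lemma back_orbit_reflect':
  "back_orbit (- b) (- a) (reflect g) x (\<lambda>j. - xb j) \<longleftrightarrow> back_orbit a b g (- x) xb"
  using back_orbit_reflect[of b a g "- x" xb] by simp

lemma Lminf_on_reflect: "Lminf_on (>) a b g m \<longleftrightarrow> Lminf_on (<) (- b) (- a) (reflect g) m"
proof -
  have *: "(\<exists>xb. back_orbit (- b) (- a) (reflect g) x xb \<and> Lminf_order (<) xb m) \<longleftrightarrow>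
    (\<exists>xb. back_orbit a b g (- x) xb \<and> Lminf_order (>) xb m)" for x
    using ex_uminus_fun[of "\<lambda>xb. back_orbit (- b) (- a) (reflect g) x xb \<and> Lminf_order (<) xb m"]
    unfolding back_orbit_reflect' order_reflect(2)[symmetric] by (rule sym)
  show ?thesis
    unfolding Lminf_on_def reflect_fixpoint * by (rule bex_reflect[symmetric])
qed

lemma Linfinf_on_reflect: "Linfinf_on (>) a b g \<longleftrightarrow> Linfinf_on (<) (- b) (- a) (reflect g)"
proof -
  have *: "(\<exists>xb yb. back_orbit (- b) (- a) (reflect g) x xb \<and> back_orbit (- b) (- a) (reflect g) x yb
      \<and> Linfinf_order (<) xb yb) \<longleftrightarrow>
    (\<exists>xb yb. back_orbit a b g (- x) xb \<and> back_orbit a b g (- x) yb \<and> Linfinf_order (>) xb yb)" for x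
  proof -
    let ?B = "back_orbit (- b) (- a) (reflect g) x"
    have "(\<exists>xb yb. ?B xb \<and> ?B yb \<and> Linfinf_order (<) xb yb) \<longleftrightarrow>
      (\<exists>xb yb. ?B (\<lambda>j. - xb j) \<and> ?B yb \<and> Linfinf_order (<) (\<lambda>j. - xb j) yb)"
      by (rule ex_uminus_fun[of "\<lambda>xb. \<exists>yb. ?B xb \<and> ?B yb \<and> Linfinf_order (<) xb yb", symmetric])
    also have "\<dots> \<longleftrightarrow> (\<exists>xb yb. ?B (\<lambda>j. - xb j) \<and> ?B (\<lambda>j. - yb j)
      \<and> Linfinf_order (<) (\<lambda>j. - xb j) (\<lambda>j. - yb j))"
      by (rule ex_cong1, rule ex_uminus_fun[of "\<lambda>yb. ?B (\<lambda>j. - xb j) \<and> ?B yb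
        \<and> Linfinf_order (<) (\<lambda>j. - xb j) yb" for xb, symmetric])
    finally show ?thesis unfolding back_orbit_reflect' order_reflect(3)[symmetric] .
  qed
  show ?thesis
    unfolding Linfinf_on_def reflect_fixpoint * by (rule bex_reflect[symmetric])
qed

section \<open>The L-properties\<close>

lemma Lmn_order_less:
  assumes "Lmn_order (<) x m n"
  shows "i < j \<Longrightarrow> j < n \<Longrightarrow> x i < x j"
    and "n \<le> i \<Longrightarrow> i < j \<Longrightarrow> j < m + n \<Longrightarrow> x j < x i"
proof -
  show "x i < x j" if "i < j" "j < n"
    using that
  proof (induction j)
    case (Suc j)
    have "x j < x (Suc j)" using assms Suc.prems by (simp add: Lmn_order_def)
    moreover have "x i \<le> x j" using Suc by (cases "i = j") auto
    ultimately show ?case by simp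
  qed simp
  show "x j < x i" if "n \<le> i" "i < j" "j < m + n"
    using that
  proof (induction j)
    case (Suc j)
    have "x (Suc j) < x j" using assms Suc.prems by (simp add: Lmn_order_def)
    moreover have "x j \<le> x i" using Suc by (cases "i = j") auto
    ultimately show ?case by simp
  qed simp
qed

lemma Lmn_order_le:
  assumes "Lmn_order (<) x m n"
  shows "i \<le> j \<Longrightarrow> j < n \<Longrightarrow> x i \<le> x j"
    and "n \<le> i \<Longrightarrow> i \<le> j \<Longrightarrow> j < m + n \<Longrightarrow> x j \<le> x i"
  using Lmn_order_less[OF assms, of i j] by (cases "i = j"; force)+

lemma Lmn_order_distinct:
  assumes "Lmn_order (<) x m n \<or> Lmn_order (>) x m n" "0 < j" "j < m + n"
  shows "x j \<noteq> x 0"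
proof -
  have *: "y j \<noteq> y 0" if "Lmn_order (<) y m n" for y :: "nat \<Rightarrow> real"
  proof (cases "j < n")
    case True
    then show ?thesis using Lmn_order_less(1)[OF that, of 0 j] assms by simp
  next
    case False
    then have "y j \<le> y n" using Lmn_order_le(2)[OF that, of n j] assms by simp
    moreover have "y n < y 0" using that by (simp add: Lmn_order_def)
    ultimately show ?thesis by simp
  qed
  show ?thesis using assms(1) *[of x] *[of "\<lambda>j. - x j"] unfolding order_reflect by auto
qed

text \<open>The order already separates \<open>x\<close> from its later orbit points, so a return
  after \<open>m+n\<close> steps is automatically the first one.\<close>

lemma Lmn_onI:
  assumes "x \<in> {a..b}" "(g ^^ (m+n)) x = x"
    and "Lmn_order lt (\<lambda>j. (g ^^ j) x) m n" "lt = (<) \<or> lt = (>)"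
  shows "Lmn_on lt a b g m n"
proof -
  have "per_pt g (m+n) x"
    unfolding per_pt_def using assms Lmn_order_distinct[of "\<lambda>j. (g ^^ j) x" m n] by auto
  then show ?thesis unfolding Lmn_on_def using assms by blast
qed

text \<open>An orbit of L-type may as well be started at its point next to the gap on the other side.\<close>

lemma Lmn_on_swap:
  assumes "Lmn_on (<) a b g m n" "interval_map a b g" "0 < m" "0 < n"
  shows "Lmn_on (>) a b g n m"
proof -
  interpret interval_map a b g by fact
  obtain x where x: "x \<in> {a..b}" "per_pt g (m+n) x" "Lmn_order (<) (\<lambda>j. (g ^^ j) x) m n"
    using assms(1) unfolding Lmn_on_def by blast
  have shift: "(g ^^ j) ((g ^^ n) x) = (g ^^ (j+n)) x" for j by (simp add: funpow_add)
  have per: "(g ^^ (m+n)) x = x" using x(2) by (simp add: per_pt_def)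
  then have wrap: "(g ^^ (j+(m+n))) x = (g ^^ j) x" for j by (simp add: funpow_add)
  have lt: "(g ^^ (j+1+n)) x < (g ^^ (j+n)) x" if "j + 1 < m" for j
    using x(3) that unfolding Lmn_order_def by (simp add: add.commute add.left_commute)
  \<comment> \<open>Indices from \<open>m\<close> on have passed the end of the cycle and run
    through the right-hand points of the original orbit.\<close>
  have gt: "(g ^^ (j+n)) x < (g ^^ (j+1+n)) x" if "m \<le> j" "j + 1 < n + m" for j
  proof -
    have "(g ^^ (j-m)) x < (g ^^ (j-m+1)) x" using x(3) that by (simp add: Lmn_order_def)
    then show ?thesis using wrap[of "j-m"] wrap[of "j-m+1"] that by (simp add: add_ac)
  qed
  have mid: "(g ^^ n) x < (g ^^ (m+n)) x" using x(3) per by (simp add: Lmn_order_def)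
  show ?thesis
  proof (rule Lmn_onI[of "(g ^^ n) x"])
    show "(g ^^ n) x \<in> {a..b}" using iter_in x(1) by blast
    show "(g ^^ (n + m)) ((g ^^ n) x) = (g ^^ n) x"
      using wrap[of n] unfolding shift by (simp add: add_ac)
    show "Lmn_order (>) (\<lambda>j. (g ^^ j) ((g ^^ n) x)) n m"
      unfolding shift Lmn_order_def using lt gt mid by simp
  qed simp
qed

section \<open>Lengthening L-cycles and unrolling them into backward orbits\<close>

context interval_map
begin

text \<open>Adjacent intervals may touch. If two consecutive points coincided, the orbit would be
  constant from then on, hence by periodicity throughout; but \<open>gap\<close> keeps the points at
  times 0 and \<open>n\<close> apart.\<close>

lemma Lmn_on_of_loop:
  assumes mn: "0 < m" "0 < n"
    and sub: "\<And>j. j < m + n \<Longrightarrow> c j \<in> {a..b} \<and> d j \<in> {a..b} \<and> c j \<le> d j"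
    and step: "\<And>j. Suc j < m + n \<Longrightarrow> covers g (closed_segment (c j) (d j)) (closed_segment (c (Suc j)) (d (Suc j)))"
    and last: "covers g (closed_segment (c (m+n-1)) (d (m+n-1))) (closed_segment (c 0) (d 0))"
    and right: "\<And>j. Suc j < n \<Longrightarrow> d j \<le> c (Suc j)"
    and gap: "d n < c 0"
    and left: "\<And>j. n \<le> j \<Longrightarrow> Suc j < m + n \<Longrightarrow> d (Suc j) \<le> c j"
  shows "Lmn_on (<) a b g m n"
proof -
  obtain x where x: "x \<in> {a..b}" "(g ^^ Suc (m+n-1)) x = x"
    "\<And>j. j \<le> m+n-1 \<Longrightarrow> (g ^^ j) x \<in> closed_segment (c j) (d j)"
    using loop[of "m+n-1" c d] sub step last mn by (metis Suc_pred' add_gr_0 le_imp_less_Suc not_less_eq)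
  have "c j \<le> (g ^^ j) x \<and> (g ^^ j) x \<le> d j" if "j < m + n" for j
    using segment_memD[OF x(3)[of j]] sub[OF that] that by simp
  note bd = this
  have neq: "(g ^^ Suc j) x \<noteq> (g ^^ j) x" if "j < m + n" for j
  proof
    assume *: "(g ^^ Suc j) x = (g ^^ j) x"
    have const: "(g ^^ (j + i)) x = (g ^^ j) x" for i
      by (induction i) (use * in auto)
    have per: "(g ^^ (m+n)) x = x" using x(2) mn by simp
    have "(g ^^ (m+n)) x = (g ^^ j) x" using const[of "m+n-j"] that by simp
    moreover have "(g ^^ (n + (m+n))) x = (g ^^ j) x" using const[of "n+(m+n)-j"] that by simp
    then have "(g ^^ n) x = (g ^^ j) x" using per by (simp add: funpow_add)
    ultimately show False using bd[of n] bd[of 0] gap per mn by simp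
  qed
  have "(g ^^ j) x < (g ^^ (j+1)) x" if "j + 1 < n" for j
    using bd[of j] bd[of "Suc j"] neq[of j] right[of j] that by simp
  moreover have "(g ^^ (j+1)) x < (g ^^ j) x" if "n \<le> j" "j + 1 < m + n" for j
    using bd[of j] bd[of "Suc j"] neq[of j] left[of j] that by simp
  moreover have "(g ^^ n) x < (g ^^ 0) x" using bd[of n] bd[of 0] gap mn by simp
  ultimately show ?thesis
    using x(1,2) mn by (intro Lmn_onI[of x]) (auto simp: Lmn_order_def)
qed

lemma Lmn_on_Suc_right:
  assumes L: "Lmn_on (<) a b g m n" and mn: "2 \<le> m" "2 \<le> n"
  shows "Lmn_on (<) a b g m (n+1)"
proof -
  obtain x0 where x0: "x0 \<in> {a..b}" "per_pt g (m+n) x0" "Lmn_order (<) (\<lambda>j. (g ^^ j) x0) m n"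
    using L unfolding Lmn_on_def by blast
  define x where "x j = (g ^^ j) x0" for j
  have ord: "Lmn_order (<) x m n" using x0(3) by (simp add: x_def[abs_def])
  note less = Lmn_order_less[OF ord] and le = Lmn_order_le[OF ord]
  have gx: "g (x j) = x (Suc j)" for j by (simp add: x_def)
  have xin: "x j \<in> {a..b}" for j unfolding x_def using iter_in x0(1) by blast
  have per: "x (m+n) = x 0" using x0(2) by (simp add: per_pt_def x_def)
  have gap: "x n < x 0" using ord by (simp add: Lmn_order_def)
  have "g (x n) < x n" "x 0 < g (x 0)"
    using less(2)[of n "Suc n"] less(1)[of 0 "Suc 0"] mn by (simp_all add: gx)
  then obtain z where z: "x n < z" "z < x 0" "g z = z" "z \<in> {a..b}"
    using fixpoint_open[OF gap] xin by metis
  obtain s where s: "z < s" "s < x 0" "g s = x 0" "s \<in> {a..b}"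
    using ivt_open[OF z(2) z(4) xin, of "x 0"] z \<open>x 0 < g (x 0)\<close> by metis
  obtain s' where s': "z < s'" "s' < s" "g s' = s" "s' \<in> {a..b}"
    using ivt_open[OF s(1) z(4) s(4), of s] z s by metis
  \<comment> \<open>On the right the intervals are bounded by \<open>s'\<close>, \<open>s\<close>,
    \<open>x 0\<close>, ..., \<open>x (n-1)\<close>, one more than \<open>n\<close>. On the left the
    first one runs from \<open>x n\<close> up to \<open>z\<close>, the others between neighbouring
    points. The interval from \<open>x (n-2)\<close> to \<open>x (n-1)\<close> jumps the gap,
    because its ends go to \<open>x (n-1)\<close> and \<open>x n\<close>.\<close>
  define c where "c j = (if j = 0 then s' else if j = 1 then s else if j \<le> n then x (j-2) else x (j-1))" for j
  define d where "d j = (if j = 0 then s else if j = 1 then x 0 else if j \<le> n then x (j-1)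
    else if j = n+1 then z else x (j-2))" for j
  have "x 0 \<le> x (n-1)" using mn by (intro le(1)) auto
  then have z_hi: "z \<le> x (n-1)" using z by simp
  have "x (n+m-1) \<le> x n" using mn by (intro le(2)) auto
  then have s_lo: "x (n+m-1) \<le> s'" using z s' by simp
  show ?thesis
  proof (rule Lmn_on_of_loop[of m "n+1" c d])
    show "c j \<in> {a..b} \<and> d j \<in> {a..b} \<and> c j \<le> d j" if "j < m + (n + 1)" for j
    proof -
      have ab: "c j \<in> {a..b} \<and> d j \<in> {a..b}"
        using xin s(4) s'(4) z(4) by (simp add: c_def d_def)
      have "x (j-2) \<le> x (j-1)" if "2 \<le> j" "j \<le> n"
        using that by (intro le(1)) auto
      moreover have "x (j-1) \<le> x (j-2)" if "n + 2 \<le> j"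
        using that \<open>j < m + (n+1)\<close> by (intro le(2)) auto
      ultimately have "c j \<le> d j"
        using s s' z mn by (auto simp: c_def d_def)
      then show ?thesis using ab by simp
    qed
    show "covers g (closed_segment (c j) (d j)) (closed_segment (c (Suc j)) (d (Suc j)))"
      if j: "Suc j < m + (n + 1)" for j
    proof -
      consider "j = 0" | "j = 1" | "2 \<le> j" "j < n" | "j = n" | "j = n+1" | "n+2 \<le> j"
        using mn by linarith
      then show ?thesis
      proof cases
        case 1
        then show ?thesis using s s' by (intro coversI[of s' _ s]) (auto simp: c_def d_def)
      next
        case 2
        then show ?thesis using s mn gx by (intro coversI[of s _ "x 0"]) (auto simp: c_def d_def)
      next
        case 3
        then have "Suc (j-2) = j-1" "Suc (j-1) = j" by auto
        then show ?thesis using 3 gx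
          by (intro coversI[of "x (j-2)" _ "x (j-1)"]) (auto simp: c_def d_def)
      next
        case 4
        then have "Suc (n-2) = n-1" "Suc (n-1) = n" using mn by auto
        then show ?thesis using 4 gx z z_hi mn
          by (intro coversI[of "x (n-1)" _ "x (n-2)"]) (auto simp: c_def d_def closed_segment_min_max)
      next
        case 5
        then show ?thesis using gx z mn \<open>g (x n) < x n\<close>
          by (intro coversI[of "x n" _ z]) (auto simp: c_def d_def closed_segment_min_max)
      next
        case 6
        then have "Suc (j-2) = j-1" "Suc (j-1) = j" by auto
        then show ?thesis using 6 gx
          by (intro coversI[of "x (j-1)" _ "x (j-2)"]) (auto simp: c_def d_def)
      qed
    qed
    show "covers g (closed_segment (c (m+(n+1)-1)) (d (m+(n+1)-1))) (closed_segment (c 0) (d 0))"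
    proof -
      have "Suc (m+n-2) = m+n-1" "Suc (m+n-1) = m+n" using mn by auto
      then show ?thesis using gx per s s' s_lo mn z
        by (intro coversI[of "x (m+n-2)" _ "x (m+n-1)"])
          (auto simp: c_def d_def closed_segment_min_max add.commute)
    qed
    show "d j \<le> c (Suc j)" if "Suc j < n + 1" for j
      using that by (auto simp: c_def d_def)
    show "d (n+1) < c 0" using s' mn by (simp add: c_def d_def)
    show "d (Suc j) \<le> c j" if "n+1 \<le> j" "Suc j < m + (n+1)" for j
      using that mn by (simp add: c_def d_def)
  qed (use mn in auto)
qed

text \<open>The fixed point in the gap is pulled back through the open intervals between
  neighbouring orbit points, against the direction of the cycle. Once the preimages have reached the
  right half of the gap they can be continued towards \<open>z\<close> forever.\<close>

lemma Lmn_on_imp_Lminf_on: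
  assumes L: "Lmn_on (<) a b g m n" and mn: "2 \<le> m" "2 \<le> n"
  shows "Lminf_on (<) a b g m"
proof -
  obtain x0 where x0: "x0 \<in> {a..b}" "per_pt g (m+n) x0" "Lmn_order (<) (\<lambda>j. (g ^^ j) x0) m n"
    using L unfolding Lmn_on_def by blast
  define x where "x j = (g ^^ j) x0" for j
  have ord: "Lmn_order (<) x m n" using x0(3) by (simp add: x_def[abs_def])
  note less = Lmn_order_less[OF ord] and le = Lmn_order_le[OF ord]
  have gx: "g (x j) = x (Suc j)" for j by (simp add: x_def)
  have xin: "x j \<in> {a..b}" for j unfolding x_def using iter_in x0(1) by blast
  have per: "x (m+n) = x 0" using x0(2) by (simp add: per_pt_def x_def)
  have gap: "x n < x 0" using ord by (simp add: Lmn_order_def)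
  have "g (x n) < x n" "x 0 < g (x 0)"
    using less(2)[of n "Suc n"] less(1)[of 0 "Suc 0"] mn by (simp_all add: gx)
  then obtain z where z: "x n < z" "z < x 0" "g z = z" "z \<in> {a..b}"
    using fixpoint_open[OF gap] xin by metis
  \<comment> \<open>Position of the \<open>j\<close>-th preimage: the left intervals from the
    outermost inwards, then from \<open>x n\<close> to \<open>z\<close>; the right intervals from
    the outermost inwards, then from \<open>z\<close> to \<open>x 0\<close>, where
    \<open>y < g y\<close> is what keeps the construction going.\<close>
  define P where "P j y \<longleftrightarrow> y \<in> {a..b} \<and> (if j = 0 then y = z
    else if j < m then x (m+n-j) < y \<and> y < x (m+n-j-1)
    else if j = m then x n < y \<and> y < z
    else if j < m + n then x (m+n-1-j) < y \<and> y < x (m+n-j)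
    else z < y \<and> y < g y \<and> y < x 0)" for j y
  define Q where "Q j y y' \<longleftrightarrow> g y' = y \<and> (m + n \<le> j \<longrightarrow> y' < y)" for j y y'
  have "\<exists>y'. P (Suc j) y' \<and> Q j y y'" if y: "P j y" for j y
  proof -
    consider "j = 0" | "0 < j" "Suc j < m" | "Suc j = m" "0 < j" | "j = m" | "m < j" "Suc j < m + n"
      | "Suc j = m + n" "m < j" | "m + n \<le> j"
      using mn by linarith
    then show ?thesis
    proof cases
      case 1
      have "x (m+n-1) \<le> x n" using mn by (intro le(2)) auto
      then have "x (m+n-1) < z" using z by simp
      moreover have "Suc (m+n-1) = m+n" "Suc (m+n-2) = m+n-1" using mn by auto
      ultimately obtain y' where "x (m+n-1) < y'" "y' < x (m+n-2)" "g y' = z" "y' \<in> {a..b}"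
        using less(2)[of "m+n-2" "m+n-1"] xin gx per z mn by - (rule ivt_open[of "x (m+n-1)" "x (m+n-2)" z], auto)
      then show ?thesis using 1 y mn by (intro exI[of _ y']) (auto simp: P_def Q_def numeral_2_eq_2)
    next
      case 2
      let ?i = "m+n-Suc j"
      have i: "Suc ?i = m+n-j" "Suc (?i-1) = ?i" "n \<le> ?i - 1" "?i < m + n" using 2 by auto
      then obtain y' where "x ?i < y'" "y' < x (?i-1)" "g y' = y" "y' \<in> {a..b}"
        using less(2)[of "?i-1" ?i] xin gx y 2 by - (rule ivt_open[of "x ?i" "x (?i-1)" y], auto simp: P_def)
      then show ?thesis using 2 by (intro exI[of _ y']) (auto simp: P_def Q_def)
    next
      case 3
      have i: "m+n-j = Suc n" "m+n-j-1 = n" using 3 by auto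
      have "y < x n" "x (Suc n) < y" using y 3 i by (auto simp: P_def)
      then obtain y' where "x n < y'" "y' < z" "g y' = y" "y' \<in> {a..b}"
        using gx z by - (rule ivt_open[OF z(1) xin z(4), of y], auto)
      then show ?thesis using 3 by (intro exI[of _ y']) (auto simp: P_def Q_def)
    next
      case 4
      have i: "Suc (n-2) = n-1" "Suc (n-1) = n" using mn by auto
      have "x n < y" "y < z" using y 4 mn by (auto simp: P_def)
      moreover have "x 0 \<le> x (n-1)" using mn by (intro le(1)) auto
      then have "z < x (n-1)" using z by simp
      ultimately obtain y' where "x (n-2) < y'" "y' < x (n-1)" "g y' = y" "y' \<in> {a..b}"
        using less(1)[of "n-2" "n-1"] xin gx z i mn by - (rule ivt_open[of "x (n-2)" "x (n-1)" y], auto)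
      then show ?thesis using 4 mn by (intro exI[of _ y']) (auto simp: P_def Q_def numeral_2_eq_2)
    next
      case 5
      let ?i = "m+n-Suc j"
      have i: "Suc ?i = m+n-j" "Suc (?i-1) = ?i" "?i < n" using 5 by auto
      then have "x ?i < y" "y < x (Suc ?i)" using y 5 by (auto simp: P_def)
      then obtain y' where "x (?i-1) < y'" "y' < x ?i" "g y' = y" "y' \<in> {a..b}"
        using less(1)[of "?i-1" ?i] xin gx i by - (rule ivt_open[of "x (?i-1)" "x ?i" y], auto)
      then show ?thesis using 5 by (intro exI[of _ y']) (auto simp: P_def Q_def)
    next
      case 6
      have i: "m+n-1-j = 0" "m+n-j = 1" using 6 by auto
      have "x 0 < y" "y < x 1" using y 6 i by (auto simp: P_def)
      then obtain y' where "z < y'" "y' < x 0" "g y' = y" "y' \<in> {a..b}"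
        using gx z by - (rule ivt_open[OF z(2) z(4) xin, of y], auto)
      then show ?thesis using 6 \<open>x 0 < y\<close> by (intro exI[of _ y']) (auto simp: P_def Q_def)
    next
      case 7
      \<comment> \<open>The point \<open>y\<close> is both the value sought and the right end of the
        search: \<open>g z = z < y < g y\<close>.\<close>
      then have "z < y" "y < g y" "y < x 0" "y \<in> {a..b}" using y mn by (auto simp: P_def)
      then obtain y' where "z < y'" "y' < y" "g y' = y" "y' \<in> {a..b}"
        using z by - (rule ivt_open[of z y y], auto)
      then show ?thesis using 7 \<open>y < x 0\<close> by (intro exI[of _ y']) (auto simp: P_def Q_def)
    qed
  qed
  moreover have "\<exists>y. P 0 y" using z by (auto simp: P_def)
  ultimately obtain xb where xb: "\<And>j. P j (xb j)" "\<And>j. Q j (xb j) (xb (Suc j))"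
    using dependent_nat_choice[of P Q] by blast
  have xb0: "xb 0 = z" using xb(1)[of 0] by (simp add: P_def)
  have bo: "back_orbit a b g z xb"
    using xb xb0 by (auto simp: back_orbit_def P_def Q_def simp del: atLeastAtMost_iff)
  have "xb j < xb (Suc j)" if "1 \<le> j" "j < m" for j
  proof (cases "Suc j = m")
    case True
    then show ?thesis using xb(1)[of j] xb(1)[of m] that by (auto simp: P_def)
  next
    case False
    then show ?thesis using xb(1)[of j] xb(1)[of "Suc j"] that by (auto simp: P_def)
  qed
  moreover have "xb m < xb 0" using xb(1)[of m] xb0 mn by (simp add: P_def)
  moreover have "xb 0 < xb j \<and> xb (Suc j) < xb j" if j: "m+1 \<le> j" for j
  proof -
    consider "Suc j < m + n" | "Suc j = m + n" | "m + n \<le> j" by linarith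
    then show ?thesis
    proof cases
      case 1
      then have "x 0 \<le> x (m+n-1-j)" using j by (intro le(1)) auto
      then show ?thesis using xb(1)[of j] xb(1)[of "Suc j"] z xb0 1 j by (auto simp: P_def)
    next
      case 2
      then have "m + n - 1 - j = 0" by simp
      then show ?thesis using xb(1)[of j] xb(1)[of "Suc j"] z xb0 2 j by (auto simp: P_def)
    next
      case 3
      then show ?thesis using xb(1)[of j] xb(2)[of j] xb0 j mn by (auto simp: P_def Q_def)
    qed
  qed
  ultimately have "Lminf_order (<) xb m" by (simp add: Lminf_order_def)
  then show ?thesis unfolding Lminf_on_def using z bo by blast
qed

text \<open>The first \<open>m\<close> preimages stay. With \<open>2 <= m\<close>, the point
  \<open>xb m\<close> is mapped to \<open>xb (m-1)\<close> below itself while \<open>z\<close> is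
  fixed, so one more preimage fits between \<open>xb m\<close> and \<open>z\<close>. After that each
  new point is squeezed between two consecutive old ones on the right.\<close>

lemma Lminf_on_Suc:
  assumes L: "Lminf_on (<) a b g m" and m: "2 \<le> m"
  shows "Lminf_on (<) a b g (m+1)"
proof -
  obtain z xb where z: "z \<in> {a..b}" "g z = z" "back_orbit a b g z xb" "Lminf_order (<) xb m"
    using L unfolding Lminf_on_def by blast
  have xb: "xb 0 = z" "\<And>j. xb j \<in> {a..b}" "\<And>j. g (xb (Suc j)) = xb j"
    using z(3) by (auto simp: back_orbit_def)
  have up: "xb j < xb (Suc j)" if "1 \<le> j" "j < m" for j
    using z(4) that by (auto simp: Lminf_order_def)
  have mid: "xb m < z" using z(4) xb(1) by (simp add: Lminf_order_def)
  have down: "z < xb j" "xb (Suc j) < xb j" if "m+1 \<le> j" for j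
    using z(4) xb(1) that by (auto simp: Lminf_order_def)
  define P where "P j y \<longleftrightarrow> y \<in> {a..b} \<and> (if j \<le> m then y = xb j
    else if j = m+1 then xb m < y \<and> y < z
    else xb j < y \<and> y < xb (j-1))" for j y
  have "\<exists>y'. P (Suc j) y' \<and> g y' = y" if y: "P j y" for j y
  proof -
    consider "j < m" | "j = m" | "j = m+1" | "m+1 < j" by linarith
    then show ?thesis
    proof cases
      case 1
      then show ?thesis using y xb by (intro exI[of _ "xb (Suc j)"]) (auto simp: P_def)
    next
      case 2
      have "g (xb m) = xb (m-1)" "xb (m-1) < xb m" using xb(3)[of "m-1"] up[of "m-1"] m by auto
      then obtain y' where "xb m < y'" "y' < z" "g y' = xb m" "y' \<in> {a..b}"
        using z mid by - (rule ivt_open[OF mid xb(2) z(1), of "xb m"], auto)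
      then show ?thesis using 2 y by (intro exI[of _ y']) (auto simp: P_def)
    next
      case 3
      then have "xb m < y" "y < z" using y by (auto simp: P_def)
      moreover have "g (xb (m+2)) = xb (m+1)" "g (xb (m+1)) = xb m" using xb(3) by auto
      moreover have "xb (m+2) < xb (m+1)" "z < xb (m+1)" using down[of "m+1"] by auto
      ultimately obtain y' where "xb (m+2) < y'" "y' < xb (m+1)" "g y' = y" "y' \<in> {a..b}"
        using xb(2) by - (rule ivt_open[of "xb (m+2)" "xb (m+1)" y], auto)
      then show ?thesis using 3 y by (intro exI[of _ y']) (auto simp: P_def)
    next
      case 4
      then have "xb j < y" "y < xb (j-1)" using y by (auto simp: P_def)
      moreover have "g (xb j) = xb (j-1)" using xb(3)[of "j-1"] 4 by auto
      ultimately obtain y' where "xb (Suc j) < y'" "y' < xb j" "g y' = y" "y' \<in> {a..b}"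
        using xb down(2)[of j] 4 by - (rule ivt_open[of "xb (Suc j)" "xb j" y], auto)
      then show ?thesis using 4 y by (intro exI[of _ y']) (auto simp: P_def)
    qed
  qed
  moreover have "\<exists>y. P 0 y" using xb by (auto simp: P_def)
  ultimately obtain yb where yb: "\<And>j. P j (yb j)" "\<And>j. g (yb (Suc j)) = yb j"
    using dependent_nat_choice[of P "\<lambda>j y y'. g y' = y"] by blast
  have yb0: "yb 0 = z" using yb(1)[of 0] xb by (simp add: P_def)
  have "back_orbit a b g z yb" using yb yb0 by (auto simp: back_orbit_def P_def simp del: atLeastAtMost_iff)
  moreover have "Lminf_order (<) yb (m+1)"
  proof -
    have "yb j < yb (Suc j)" if "1 \<le> j" "j < m+1" for j
      using yb(1)[of j] yb(1)[of "Suc j"] up[of j] that by (cases "j = m") (auto simp: P_def)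
    moreover have "yb (m+1) < yb 0" using yb(1)[of "m+1"] yb0 by (simp add: P_def)
    moreover have "yb 0 < yb j \<and> yb (Suc j) < yb j" if "m+2 \<le> j" for j
      using yb(1)[of j] yb(1)[of "Suc j"] down(1)[of j] yb0 that by (auto simp: P_def)
    ultimately show ?thesis by (simp add: Lminf_order_def)
  qed
  ultimately show ?thesis unfolding Lminf_on_def using z by blast
qed

text \<open>On the left, \<open>xb m\<close> is moved away from \<open>z\<close>, which yields
  preimages climbing towards \<open>z\<close>. On the right, \<open>xb (m+1)\<close> jumps across
  \<open>z\<close> while \<open>xb (m+2)\<close> does not, so \<open>z\<close> has a preimage
  between them from which a second backward orbit starts.\<close>

lemma Lminf_on_imp_Linfinf_on:
  assumes L: "Lminf_on (<) a b g m" and m: "2 \<le> m"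
  shows "Linfinf_on (<) a b g"
proof -
  obtain z xb where z: "z \<in> {a..b}" "g z = z" "back_orbit a b g z xb" "Lminf_order (<) xb m"
    using L unfolding Lminf_on_def by blast
  have xb: "xb 0 = z" "\<And>j. xb j \<in> {a..b}" "\<And>j. g (xb (Suc j)) = xb j"
    using z(3) by (auto simp: back_orbit_def)
  have up: "xb j < xb (Suc j)" if "1 \<le> j" "j < m" for j
    using z(4) that by (auto simp: Lminf_order_def)
  have mid: "xb m < z" using z(4) xb(1) by (simp add: Lminf_order_def)
  have down: "z < xb j" "xb (Suc j) < xb j" if "m+1 \<le> j" for j
    using z(4) xb(1) that by (auto simp: Lminf_order_def)
  have up_m: "xb j \<le> xb m" if "1 \<le> j" "j \<le> m" for j
    using that(2,1)
  proof (induction j rule: inc_induct)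
    case (step i)
    then show ?case using up[of i] by simp
  qed simp
  have "\<exists>l. l 0 = z \<and> (\<forall>j. l j \<in> {a..b}) \<and> (\<forall>j. g (l (Suc j)) = l j)
    \<and> (\<forall>j\<ge>1. l j < l (Suc j) \<and> l j < z)"
  proof -
    \<comment> \<open>Below index \<open>m\<close> the old orbit is followed; from \<open>m\<close>
      on only \<open>g y < y < z\<close> is required. A preimage of \<open>y\<close> between
      \<open>y\<close> and \<open>z\<close> inherits this property.\<close>
    define P where "P j y \<longleftrightarrow> y \<in> {a..b} \<and> (if j < m then y = xb j else y < z \<and> g y < y)" for j y
    define Q where "Q j y y' \<longleftrightarrow> g y' = y \<and> (m \<le> j \<longrightarrow> y < y')" for j y y'
    have gm: "g (xb m) < xb m" using xb(3)[of "m-1"] up[of "m-1"] m by auto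
    have "\<exists>y'. P (Suc j) y' \<and> Q j y y'" if y: "P j y" for j y
    proof (cases "j < m")
      case True
      then show ?thesis using y xb mid gm
        by (intro exI[of _ "xb (Suc j)"]) (auto simp: P_def Q_def not_less le_antisym dest!: le_antisym[of m])
    next
      case False
      then have "y < z" "g y < y" "y \<in> {a..b}" using y by (auto simp: P_def)
      then obtain y' where "y < y'" "y' < z" "g y' = y" "y' \<in> {a..b}"
        using z by - (rule ivt_open[of y z y], auto)
      then show ?thesis using False by (intro exI[of _ y']) (auto simp: P_def Q_def)
    qed
    moreover have "\<exists>y. P 0 y" using xb m by (auto simp: P_def)
    ultimately obtain l where l: "\<And>j. P j (l j)" "\<And>j. Q j (l j) (l (Suc j))"
      using dependent_nat_choice[of P Q] by blast
    have "l j < l (Suc j) \<and> l j < z" if "1 \<le> j" for j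
    proof (cases "j < m")
      case True
      have "g (l (Suc j)) = l j" using l(2)[of j] by (simp add: Q_def)
      moreover have "g (l (Suc j)) < l (Suc j)"
        using l(1)[of "Suc j"] xb(3)[of j] up[OF that True] by (auto simp: P_def split: if_splits)
      ultimately show ?thesis using l(1)[of j] True up_m[of j] mid that by (auto simp: P_def)
    next
      case False
      then show ?thesis using l(1)[of j] l(2)[of j] by (auto simp: P_def Q_def)
    qed
    then show ?thesis using l xb m
      by (intro exI[of _ l]) (auto simp: P_def Q_def simp del: atLeastAtMost_iff dest: spec[of _ 0])
  qed
  then obtain l where l: "l 0 = z" "\<And>j. l j \<in> {a..b}" "\<And>j. g (l (Suc j)) = l j"
    "\<And>j. 1 \<le> j \<Longrightarrow> l j < l (Suc j) \<and> l j < z" by blast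
  \<comment> \<open>The offset places the first preimage of \<open>z\<close> between
    \<open>xb (m+2)\<close> and \<open>xb (m+1)\<close>; the later ones interlace with
    \<open>xb\<close>.\<close>
  define P where "P j y \<longleftrightarrow> y \<in> {a..b} \<and> (if j = 0 then y = z else xb (m+1+j) < y \<and> y < xb (m+j))" for j y
  have "\<exists>y'. P (Suc j) y' \<and> g y' = y" if y: "P j y" for j y
  proof -
    have "g (xb (m+2+j)) = xb (m+1+j)" "g (xb (m+1+j)) = xb (m+j)" using xb(3) by auto
    moreover have "xb (m+2+j) < xb (m+1+j)" using down(2)[of "m+1+j"] by simp
    moreover have "y < xb (m+1+j) \<and> xb (m+j) < y \<or> xb (m+1+j) < y \<and> y < xb (m+j)"
      using y mid down(1)[of "m+1"] by (cases "j = 0") (auto simp: P_def)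
    ultimately obtain y' where "xb (m+2+j) < y'" "y' < xb (m+1+j)" "g y' = y" "y' \<in> {a..b}"
      using ivt_open[of "xb (m+2+j)" "xb (m+1+j)" y] xb(2) by metis
    then show ?thesis by (intro exI[of _ y']) (auto simp: P_def)
  qed
  moreover have "\<exists>y. P 0 y" using xb z by (auto simp: P_def)
  ultimately obtain r where r: "\<And>j. P j (r j)" "\<And>j. g (r (Suc j)) = r j"
    using dependent_nat_choice[of P "\<lambda>j y y'. g y' = y"] by blast
  have r0: "r 0 = z" using r(1)[of 0] by (simp add: P_def)
  have "z < r j \<and> r (Suc j) < r j" if "1 \<le> j" for j
    using r(1)[of j] r(1)[of "Suc j"] down(1)[of "m+1+j"] that by (auto simp: P_def)
  then have "Linfinf_order (<) l r" using l r0 by (simp add: Linfinf_order_def)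
  moreover have "back_orbit a b g z l" using l by (simp add: back_orbit_def)
  moreover have "back_orbit a b g z r"
    using r r0 by (auto simp: back_orbit_def P_def simp del: atLeastAtMost_iff)
  ultimately show ?thesis unfolding Linfinf_on_def using z by blast
qed

end

lemma Linfinf_prop_imp_Linf_prop:
  assumes "Linfinf_prop f a b k"
  shows "Linf_prop f a b k"
proof -
  obtain x xb yb where x: "x \<in> {a..b}" "(f ^^ k) x = x" "back_orbit a b (f ^^ k) x yb"
    and "Linfinf_order (<) xb yb \<or> Linfinf_order (>) xb yb"
    using assms unfolding Linfinf_prop_def by blast
  then have "Linf_order (<) yb \<or> Linf_order (>) yb"
    by (auto simp: Linfinf_order_def Linf_order_def)
  then show ?thesis unfolding Linf_prop_def using x by blast
qed

section \<open>Stefan cycles\<close>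

lemma S_order_less:
  assumes "S_order (<) x n"
  shows "i < j \<Longrightarrow> j \<le> n \<Longrightarrow> x (2*j) < x (2*i)"
    and "i < j \<Longrightarrow> j < n \<Longrightarrow> x (2*i+1) < x (2*j+1)"
proof -
  show "x (2*j) < x (2*i)" if "i < j" "j \<le> n"
    using that
  proof (induction j)
    case (Suc j)
    have "x (2*Suc j) < x (2*j)" using assms Suc.prems by (simp add: S_order_def)
    moreover have "x (2*j) \<le> x (2*i)" using Suc by (cases "i = j") auto
    ultimately show ?case by simp
  qed simp
  show "x (2*i+1) < x (2*j+1)" if "i < j" "j < n"
    using that
  proof (induction j)
    case (Suc j)
    have "x (2*j+1) < x (2*j+3)" using assms Suc.prems by (simp add: S_order_def)
    moreover have "x (2*i+1) \<le> x (2*j+1)" using Suc by (cases "i = j") auto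
    ultimately show ?case by (simp add: numeral_3_eq_3)
  qed simp
qed

lemma S_order_le:
  assumes "S_order (<) x n"
  shows "i \<le> j \<Longrightarrow> j \<le> n \<Longrightarrow> x (2*j) \<le> x (2*i)"
    and "i \<le> j \<Longrightarrow> j < n \<Longrightarrow> x (2*i+1) \<le> x (2*j+1)"
  using S_order_less[OF assms, of i j] by (cases "i = j"; force)+

lemma S_order_distinct:
  assumes "S_order (<) x n \<or> S_order (>) x n" "0 < j" "j < 2*n+1"
  shows "x j \<noteq> x 0"
proof -
  have *: "y j \<noteq> y 0" if y: "S_order (<) y n" for y :: "nat \<Rightarrow> real"
  proof (cases "even j")
    case True
    then obtain i where "j = 2*i" by blast
    then show ?thesis using S_order_less(1)[OF y, of 0 i] assms by simp
  next
    case False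
    then obtain i where i: "j = 2*i+1" by (blast elim: oddE)
    then have "y (2*0+1) \<le> y j" using S_order_le(2)[OF y, of 0 i] assms by simp
    then show ?thesis using y by (simp add: S_order_def)
  qed
  show ?thesis using assms(1) *[of x] *[of "\<lambda>j. - x j"] unfolding order_reflect by auto
qed

lemma funpow_fixpoint: "g x = x \<Longrightarrow> (g ^^ j) x = x"
  by (induction j) auto

lemma funpow_cycle: "(g ^^ q) x = x \<Longrightarrow> (g ^^ (q * j)) x = x"
  using funpow_fixpoint[of "g ^^ q" x j] by (simp add: funpow_mult)

text \<open>Weak inequalities suffice. If the points at times \<open>j\<close> and
  \<open>j+2\<close> coincide, that point has period dividing both 2 and the odd number
  \<open>2*n+1\<close>, so it is fixed; then the whole cycle is this point, contrary to
  \<open>ne\<close>.\<close>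

lemma S_onI:
  assumes x: "x \<in> {a..b}" "(g ^^ (2*n+1)) x = x"
    and ord: "S_order (\<lambda>u v. lt u v \<or> u = v) (\<lambda>j. (g ^^ j) x) n"
    and lt: "lt = (<) \<or> lt = (>)" and ne: "(g ^^ 2) x \<noteq> g x"
  shows "S_on lt a b g n"
proof -
  have neq: "(g ^^ (j+2)) x \<noteq> (g ^^ j) x" for j
  proof
    define y where "y = (g ^^ j) x"
    assume "(g ^^ (j+2)) x = (g ^^ j) x"
    then have "(g ^^ 2) y = y" by (simp add: y_def numeral_2_eq_2)
    then have "(g ^^ (2*n)) y = y" by (rule funpow_cycle)
    moreover have "(g ^^ (2*n+1)) y = (g ^^ j) ((g ^^ (2*n+1)) x)"
      unfolding y_def by (metis add.commute comp_apply funpow_add)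
    then have "(g ^^ (2*n+1)) y = y" unfolding x(2) y_def .
    ultimately have "g y = y" by simp
    \<comment> \<open>The fixed point \<open>y\<close> is reached at time \<open>j\<close>; another
      \<open>2*n*j\<close> steps lead to time \<open>(2*n+1)*j\<close>, a multiple of the period, so
      \<open>y\<close> is \<open>x\<close> itself.\<close>
    then have "(g ^^ (2*n*j)) y = y" by (rule funpow_fixpoint)
    moreover have "(g ^^ (2*n*j)) y = (g ^^ ((2*n+1)*j)) x"
      unfolding y_def by (metis add_mult_distrib comp_apply funpow_add mult_1)
    ultimately have "y = x" using funpow_cycle[OF x(2)] by simp
    with \<open>g y = y\<close> ne show False by (simp add: numeral_2_eq_2)
  qed
  have "S_order lt (\<lambda>j. (g ^^ j) x) n"
    unfolding S_order_def
  proof (intro conjI allI impI)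
    show "lt ((g ^^ (2*j+2)) x) ((g ^^ (2*j)) x)" if "j < n" for j
      using ord neq[of "2*j"] that unfolding S_order_def by blast
    show "lt ((g ^^ 0) x) ((g ^^ 1) x)"
    proof -
      have "g x \<noteq> x" using ne by (auto simp: numeral_2_eq_2)
      then show ?thesis using ord unfolding S_order_def by auto
    qed
    show "lt ((g ^^ (2*j+1)) x) ((g ^^ (2*j+3)) x)" if "j + 1 < n" for j
    proof -
      have "2*j+3 = 2*j+1+2" by simp
      then show ?thesis using ord neq[of "2*j+1"] that unfolding S_order_def by metis
    qed
  qed
  moreover from this have "per_pt g (2*n+1) x"
    unfolding per_pt_def using x lt S_order_distinct[of "\<lambda>j. (g ^^ j) x" n] by auto
  ultimately show ?thesis unfolding S_on_def using x by blast
qed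

lemma covers_reflect:
  assumes "covers g (closed_segment u v) (closed_segment p q)"
  shows "covers (reflect g) (closed_segment (- u) (- v)) (closed_segment (- p) (- q))"
proof -
  have *: "- x \<in> closed_segment (- u) (- v) \<longleftrightarrow> x \<in> closed_segment u v" for x u v :: real
    by (auto simp: closed_segment_min_max min_def max_def)
  obtain s t where st: "s \<in> closed_segment u v" "t \<in> closed_segment u v"
    "closed_segment p q \<subseteq> closed_segment (g s) (g t)"
    using assms unfolding covers_def by blast
  have "x \<in> closed_segment (- g s) (- g t)" if "x \<in> closed_segment (- p) (- q)" for x
    using st(3) that *[of "- x"] by (metis minus_minus subsetD)
  then show ?thesis
    using st(1,2) by (intro coversI[of "- s" _ "- t"]) (auto simp: * reflect_def)
qed

section \<open>Stefan cycles from spirals, their lengthening, and the periods they force\<close>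

context interval_map
begin

text \<open>The points \<open>Y j\<close> spiral outwards; the \<open>j\<close>-th interval of the loop lies between
  \<open>Y j\<close> and \<open>Y (j + 2)\<close>.\<close>

lemma S_on_of_spiral:
  assumes n: "1 \<le> n"
    and Y: "\<And>j. j \<le> 2*n+2 \<Longrightarrow> Y j \<in> {a..b}"
    and step: "\<And>j. j < 2*n \<Longrightarrow> covers g (closed_segment (Y j) (Y (j+2))) (closed_segment (Y (j+1)) (Y (j+3)))"
    and last: "covers g (closed_segment (Y (2*n)) (Y (2*n+2))) (closed_segment (Y 0) (Y 2))"
    and even: "\<And>j. j \<le> n \<Longrightarrow> Y (2*j+2) \<le> Y (2*j)"
    and odd: "\<And>j. j < n \<Longrightarrow> Y (2*j+1) \<le> Y (2*j+3)"
    and mid: "Y 0 \<le> Y 1" "Y 2 < Y 1"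
  shows "S_on (<) a b g n"
proof -
  obtain x where x: "x \<in> {a..b}" "(g ^^ Suc (2*n)) x = x"
    "\<And>j. j \<le> 2*n \<Longrightarrow> (g ^^ j) x \<in> closed_segment (Y j) (Y (j+2))"
  proof (rule loop[of "2*n" Y "\<lambda>j. Y (j+2)"])
    show "covers g (closed_segment (Y (2*n)) (Y (2*n+2))) (closed_segment (Y 0) (Y (0+2)))"
      using last by (simp only: add_0)
    show "covers g (closed_segment (Y j) (Y (j+2))) (closed_segment (Y (Suc j)) (Y (Suc j+2)))"
      if "j < 2*n" for j
      using step[OF that] by (simp add: numeral_3_eq_3)
  qed (use Y in auto)
  have ev: "Y (2*j+2) \<le> (g ^^ (2*j)) x \<and> (g ^^ (2*j)) x \<le> Y (2*j)" if "j \<le> n" for j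
    using x(3)[of "2*j"] even[OF that] that by (auto simp: closed_segment_eq_real_ivl split: if_splits)
  have od: "Y (2*j+1) \<le> (g ^^ (2*j+1)) x \<and> (g ^^ (2*j+1)) x \<le> Y (2*j+3)" if "j < n" for j
    using segment_memD[OF x(3)[of "2*j+1"]] odd[OF that] that by (simp add: numeral_3_eq_3)
  \<comment> \<open>The strict inequality \<open>Y 2 < Y 1\<close> separates the points at times 1
    and 2 and so supplies the nondegeneracy condition of \<open>S_onI\<close>.\<close>
  have o0: "Y 1 \<le> g x" using od[of 0] n by simp
  have e1: "(g ^^ 2) x \<le> Y 2" using ev[of 1] n by simp
  show ?thesis
  proof (rule S_onI[of x])
    show "S_order (\<lambda>u v. u < v \<or> u = v) (\<lambda>j. (g ^^ j) x) n"
      unfolding S_order_def order_le_less[symmetric]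
    proof (intro conjI allI impI)
      show "(g ^^ (2*j+2)) x \<le> (g ^^ (2*j)) x" if "j < n" for j
        using ev[of j] ev[of "j+1"] that by simp
      show "(g ^^ 0) x \<le> (g ^^ 1) x" using ev[of 0] o0 mid by simp
      show "(g ^^ (2*j+1)) x \<le> (g ^^ (2*j+3)) x" if "j + 1 < n" for j
        using od[of j] od[of "j+1"] that by (simp add: numeral_3_eq_3)
    qed
    show "(g ^^ 2) x \<noteq> g x" using o0 e1 mid by linarith
  qed (use x in auto)
qed

lemma S_on_of_spiral_reversed:
  assumes n: "1 \<le> n"
    and Y: "\<And>j. j \<le> 2*n+2 \<Longrightarrow> Y j \<in> {a..b}"
    and step: "\<And>j. j < 2*n \<Longrightarrow> covers g (closed_segment (Y j) (Y (j+2))) (closed_segment (Y (j+1)) (Y (j+3)))"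
    and last: "covers g (closed_segment (Y (2*n)) (Y (2*n+2))) (closed_segment (Y 0) (Y 2))"
    and even: "\<And>j. j \<le> n \<Longrightarrow> Y (2*j) \<le> Y (2*j+2)"
    and odd: "\<And>j. j < n \<Longrightarrow> Y (2*j+3) \<le> Y (2*j+1)"
    and mid: "Y 1 \<le> Y 0" "Y 1 < Y 2"
  shows "S_on (>) a b g n"
  unfolding S_on_reflect
proof (rule interval_map.S_on_of_spiral[where Y = "\<lambda>j. - Y j"])
  show "interval_map (- b) (- a) (reflect g)"
    by (rule interval_map_reflect) unfold_locales
qed (use assms in \<open>auto intro!: covers_reflect\<close>)

text \<open>Two points \<open>d\<close> and \<open>e\<close> on either side of the fixed point, with
  \<open>d\<close> mapped to \<open>e\<close> and \<open>e\<close> to \<open>x 0\<close>, add an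
  inner turn to the spiral and lengthen the loop by two.\<close>

lemma S_on_Suc:
  assumes S: "S_on (<) a b g n" and n: "1 \<le> n"
  shows "S_on (<) a b g (n+1)"
proof -
  obtain x0 where x0: "x0 \<in> {a..b}" "per_pt g (2*n+1) x0" "S_order (<) (\<lambda>j. (g ^^ j) x0) n"
    using S unfolding S_on_def by blast
  define x where "x j = (g ^^ j) x0" for j
  have ord: "S_order (<) x n" using x0(3) by (simp add: x_def[abs_def])
  note less = S_order_less[OF ord] and le = S_order_le[OF ord]
  have gx: "g (x j) = x (Suc j)" for j by (simp add: x_def)
  have xin: "x j \<in> {a..b}" for j unfolding x_def using iter_in x0(1) by blast
  have per: "x (2*n+1) = x 0" using x0(2) by (simp add: per_pt_def x_def)
  have 01: "x 0 < x 1" using ord by (simp add: S_order_def)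
  have 20: "x 2 < x 0" using less(1)[of 0 1] n by simp
  have g0: "g (x 0) = x 1" and g1: "g (x 1) = x 2" using gx by (simp_all add: numeral_2_eq_2)
  obtain z where z: "x 0 < z" "z < x 1" "g z = z" "z \<in> {a..b}"
    using fixpoint_open[OF 01 xin xin] 01 20 g0 g1 by auto
  obtain e where e: "z < e" "e < x 1" "g e = x 0" "e \<in> {a..b}"
    using 01 20 g0 g1 z by - (rule ivt_open[OF z(2) z(4) xin, of "x 0"], auto)
  obtain d where d: "x 0 < d" "d < z" "g d = e" "d \<in> {a..b}"
    using e g0 z by - (rule ivt_open[OF z(1) xin z(4), of e], auto)
  \<comment> \<open>Both sides of the spiral start at \<open>z\<close>, hence the repeated value:
    intervals 0 and 1 run from \<open>z\<close> to \<open>d\<close> and from \<open>z\<close> to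
    \<open>e\<close>. The old cycle follows with its index shifted by 4.\<close>
  define Y where "Y j = (if j \<le> 1 then z else if j = 2 then d else if j = 3 then e else x (j-4))" for j
  have ev: "x (2*j+2) \<le> x (2*j)" if "j < n" for j
    using ord that unfolding S_order_def by (simp add: less_imp_le)
  have od: "x (2*j+1) \<le> x (2*j+3)" if "j + 1 < n" for j
    using ord that unfolding S_order_def by (simp add: less_imp_le)
  show ?thesis
  proof (rule S_on_of_spiral[where Y = Y])
    show "Y j \<in> {a..b}" for j unfolding Y_def using z d e xin by simp
    show "covers g (closed_segment (Y j) (Y (j+2))) (closed_segment (Y (j+1)) (Y (j+3)))"
      if "j < 2*(n+1)" for j
    proof -
      consider "j = 0" | "j = 1" | "j = 2" | "j = 3" | "4 \<le> j" by linarith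
      then show ?thesis
      proof cases
        case 1
        then show ?thesis using z d by (intro coversI[of z _ d]) (auto simp: Y_def)
      next
        case 2
        then show ?thesis using z d e
          by (intro coversI[of z _ e]) (auto simp: Y_def closed_segment_min_max)
      next
        case 3
        then show ?thesis using d g0 by (intro coversI[of d _ "x 0"]) (auto simp: Y_def)
      next
        case 4
        then show ?thesis using e g1 by (intro coversI[of e _ "x 1"]) (auto simp: Y_def)
      next
        case 5
        have "j + 2 - 4 = j - 2" "j + 1 - 4 = Suc (j - 4)" "j + 3 - 4 = Suc (j - 2)" using 5 by auto
        then show ?thesis using 5 gx
          by (intro coversI[of "x (j-4)" _ "x (j-2)"]) (auto simp: Y_def)
      qed
    qed
    show "covers g (closed_segment (Y (2*(n+1))) (Y (2*(n+1)+2))) (closed_segment (Y 0) (Y 2))"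
    proof (rule coversI[of "x (2*n-2)" _ "x (2*n)"])
      show "x (2*n-2) \<in> closed_segment (Y (2*(n+1))) (Y (2*(n+1)+2))"
        "x (2*n) \<in> closed_segment (Y (2*(n+1))) (Y (2*(n+1)+2))"
        using n by (auto simp: Y_def)
      have "Suc (2*n-2) = 2*(n-1)+1" using n by simp
      then have "g (x (2*n-2)) = x (2*(n-1)+1)" using gx by metis
      moreover have "x (2*0+1) \<le> x (2*(n-1)+1)" using n by (intro le(2)) auto
      moreover have "g (x (2*n)) = x 0" using gx per by simp
      ultimately show "closed_segment (Y 0) (Y 2) \<subseteq> closed_segment (g (x (2*n-2))) (g (x (2*n)))"
        using z d by (auto simp: Y_def closed_segment_min_max)
    qed
    show "Y (2*j+2) \<le> Y (2*j)" if "j \<le> n+1" for j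
    proof -
      consider "j = 0" | "j = 1" | "2 \<le> j" by linarith
      then show ?thesis
      proof cases
        case 3
        then have "2*j+2-4 = 2*(j-2)+2" "2*j-4 = 2*(j-2)" by auto
        then show ?thesis using ev[of "j-2"] that 3 by (simp add: Y_def)
      qed (use d in \<open>auto simp: Y_def\<close>)
    qed
    show "Y (2*j+1) \<le> Y (2*j+3)" if "j < n+1" for j
    proof -
      consider "j = 0" | "j = 1" | "2 \<le> j" by linarith
      then show ?thesis
      proof cases
        case 3
        then have "2*j+1-4 = 2*(j-2)+1" "2*j+3-4 = 2*(j-2)+3" by auto
        then show ?thesis using od[of "j-2"] that 3 by (simp add: Y_def)
      qed (use e in \<open>auto simp: Y_def\<close>)
    qed
  qed (use d in \<open>auto simp: Y_def\<close>)
qed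

text \<open>The segment from \<open>x 0\<close> to \<open>x 1\<close> covers itself, so a loop may
  linger there as long as desired before running outwards along the cycle. Only the last interval
  reaches below \<open>x (2*n-2)\<close>, which makes the period exact.\<close>

lemma S_on_imp_period:
  assumes S: "S_on (<) a b g n" and n: "1 \<le> n" and N: "2*n+1 \<le> N"
  shows "\<exists>y\<in>{a..b}. per_pt g N y"
proof -
  obtain x0 where x0: "x0 \<in> {a..b}" "per_pt g (2*n+1) x0" "S_order (<) (\<lambda>j. (g ^^ j) x0) n"
    using S unfolding S_on_def by blast
  define x where "x j = (g ^^ j) x0" for j
  have ord: "S_order (<) x n" using x0(3) by (simp add: x_def[abs_def])
  note less = S_order_less[OF ord] and le = S_order_le[OF ord]
  have gx: "g (x j) = x (Suc j)" for j by (simp add: x_def)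
  have xin: "x j \<in> {a..b}" for j unfolding x_def using iter_in x0(1) by blast
  have per: "x (2*n+1) = x 0" using x0(2) by (simp add: per_pt_def x_def)
  have 01: "x 0 < x 1" using ord by (simp add: S_order_def)
  have 20: "x 2 < x 0" using less(1)[of 0 1] n by simp
  have g0: "g (x 0) = x 1" and g1: "g (x 1) = x 2" using gx by (simp_all add: numeral_2_eq_2)
  \<comment> \<open>Times 0 to \<open>t\<close> are spent between \<open>x 0\<close> and
    \<open>x 1\<close>; the other \<open>2*n-1\<close> times use the segments from
    \<open>x i\<close> to \<open>x (i+2)\<close> with \<open>i < 2*n-1\<close>.\<close>
  define t where "t = N - 2*n"
  have t: "1 \<le> t" "N = t + 2*n" using N by (auto simp: t_def)
  define u v where "u j = (if j \<le> t then x 0 else x (j-t+1))"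
    and "v j = (if j \<le> t then x 1 else x (j-t-1))" for j
  have g_last: "g (x (2*n)) = x 0" "g (x (2*n-2)) = x (2*(n-1)+1)"
  proof -
    have "Suc (2*n-2) = 2*(n-1)+1" using n by simp
    then show "g (x (2*n-2)) = x (2*(n-1)+1)" using gx by metis
    show "g (x (2*n)) = x 0" using gx per by simp
  qed
  have x1_le: "x 1 \<le> x (2*(n-1)+1)" using le(2)[of 0 "n-1"] n by simp
  obtain y where y: "y \<in> {a..b}" "(g ^^ Suc (N-1)) y = y"
    "\<And>j. j \<le> N-1 \<Longrightarrow> (g ^^ j) y \<in> closed_segment (u j) (v j)"
  proof (rule loop[of "N-1" u v])
    show "covers g (closed_segment (u j) (v j)) (closed_segment (u (Suc j)) (v (Suc j)))"
      if "j < N-1" for j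
    proof -
      consider "j < t" | "j = t" | "t < j" by linarith
      then show ?thesis
      proof cases
        case 1
        then show ?thesis using g0 g1 01 20
          by (intro coversI[of "x 0" _ "x 1"]) (auto simp: u_def v_def closed_segment_min_max)
      next
        case 2
        then show ?thesis using g0 g1 01 20
          by (intro coversI[of "x 0" _ "x 1"]) (auto simp: u_def v_def closed_segment_min_max numeral_2_eq_2)
      next
        case 3
        then have "Suc j - t + 1 = Suc (j-t+1)" "Suc j - t - 1 = Suc (j-t-1)" by auto
        then show ?thesis using 3 gx
          by (intro coversI[of "x (j-t+1)" _ "x (j-t-1)"]) (auto simp: u_def v_def)
      qed
    qed
    show "covers g (closed_segment (u (N-1)) (v (N-1))) (closed_segment (u 0) (v 0))"
    proof -
      have "N - 1 - t + 1 = 2*n" "N - 1 - t - 1 = 2*n-2" "t < N - 1" using t n by auto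
      then show ?thesis using g_last x1_le 01
        by (intro coversI[of "x (2*n)" _ "x (2*n-2)"]) (auto simp: u_def v_def closed_segment_min_max)
    qed
  qed (use xin in \<open>auto simp: u_def v_def\<close>)
  have N1: "Suc (N-1) = N" using N by simp
  have per_y: "(g ^^ N) y = y" using y(2) unfolding N1 .
  have low: "x (2*n-2) \<le> (g ^^ i) y" if "i < N - 1" for i
  proof (cases "i \<le> t")
    case True
    have "x (2*(n-1)) \<le> x (2*0)" using n by (intro le(1)) auto
    moreover have "x 0 \<le> (g ^^ i) y"
      using segment_memD(1)[OF y(3)[of i]] 01 True that by (simp add: u_def v_def)
    ultimately show ?thesis by (simp add: right_diff_distrib')
  next
    case False
    have mem: "(g ^^ i) y \<in> closed_segment (x (i-t+1)) (x (i-t-1))"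
      using y(3)[of i] False that by (simp add: u_def v_def)
    have bound: "x (2*n-2) \<le> x k" if "k < 2*n" for k
    proof (cases "even k")
      case True
      then obtain l where "k = 2*l" by blast
      then show ?thesis using le(1)[of l "n-1"] that by (simp add: right_diff_distrib')
    next
      case False
      then obtain l where l: "k = 2*l+1" by (blast elim: oddE)
      have "x (2*(n-1)) \<le> x (2*0)" using n by (intro le(1)) auto
      moreover have "x (2*0+1) \<le> x (2*l+1)" using l that by (intro le(2)) auto
      ultimately show ?thesis using 01 l by (simp add: right_diff_distrib')
    qed
    have "i - t + 1 < 2*n" "i - t - 1 < 2*n" using False that t by auto
    from bound[OF this(1)] bound[OF this(2)] mem show ?thesis
      by (auto simp: closed_segment_eq_real_ivl split: if_splits)
  qed
  have high: "(g ^^ (N-1)) y \<le> x (2*n-2)"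
  proof -
    have i: "N - 1 - t + 1 = 2*n" "N - 1 - t - 1 = 2*n-2" "\<not> N - 1 \<le> t" using t n by auto
    have "(g ^^ (N-1)) y \<in> closed_segment (u (N-1)) (v (N-1))" by (rule y(3)) simp
    then have mem: "(g ^^ (N-1)) y \<in> closed_segment (x (2*n)) (x (2*n-2))"
      unfolding u_def v_def using i by simp
    have "x (2*n) \<le> x (2*(n-1))" by (intro le(1)) auto
    then show ?thesis using segment_memD(2)[OF mem] by (simp add: right_diff_distrib')
  qed
  \<comment> \<open>An earlier return repeats the last position in an earlier interval. The two can
    only share \<open>x (2*n-2)\<close>, whence \<open>y = x (2*n-1)\<close>. Its image
    \<open>x (2*n)\<close> lies below \<open>x 0\<close>, yet the loop demands
    \<open>x 0 \<le> g y\<close> at time 1.\<close>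
  have "(g ^^ j) y \<noteq> y" if j: "0 < j" "j < N" for j
  proof
    assume eq: "(g ^^ j) y = y"
    have "(g ^^ (N-1)) y = (g ^^ (N-1-j)) ((g ^^ j) y)"
      using j by (metis (no_types, lifting) Suc_pred' add.commute comp_apply diff_add_inverse2 funpow_add
        le_add_diff_inverse2 less_Suc_eq_le less_trans)
    then have "(g ^^ (N-1)) y = x (2*n-2)"
      using low[of "N-1-j"] high j eq by simp
    then have "g ((g ^^ (N-1)) y) = x (2*(n-1)+1)" using g_last by simp
    moreover have "g ((g ^^ (N-1)) y) = y" using y(2) by simp
    ultimately have y_eq: "y = x (2*(n-1)+1)" by simp
    have "Suc (2*(n-1)+1) = 2*n" using n by simp
    then have "g y = x (2*n)" unfolding y_eq gx by simp
    moreover have "g y \<in> closed_segment (u 1) (v 1)" using y(3)[of 1] N n by simp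
    then have "x 0 \<le> g y" using t 01 by (auto simp: u_def v_def closed_segment_eq_real_ivl)
    moreover have "x (2*n) < x (2*0)" using n by (intro less(1)) auto
    ultimately show False by simp
  qed
  then show ?thesis unfolding per_pt_def using per_y y(1) by blast
qed

end

section \<open>Odd periods force Stefan cycles\<close>

context interval_map
begin

text \<open>The points \<open>y j\<close> are chosen greedily: \<open>y (j + 1)\<close> is the outermost image of an orbit
  point lying between \<open>y j\<close> and \<open>z\<close>. As the orbit has odd cardinality, some orbit
  point does not change sides; \<open>N\<close> is the first stage at which one is met. The loop closes
  there, with length \<open>N + 1\<close> or \<open>N + 2\<close>, whichever is odd.\<close>

lemma stefan_of_odd_orbit_aux:
  assumes fin: "finite Orb" and OI: "Orb \<subseteq> {a..b}" and gO: "g ` Orb \<subseteq> Orb"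
    and minimal: "\<And>C. C \<subseteq> Orb \<Longrightarrow> C \<noteq> {} \<Longrightarrow> g ` C \<subseteq> C \<Longrightarrow> C = Orb"
    and oddO: "odd (card Orb)" and pO: "p \<in> Orb" and rO: "r \<in> Orb" and pr: "p < r"
    and gap: "\<And>x. x \<in> Orb \<Longrightarrow> x \<le> p \<or> r \<le> x"
    and gp: "r < g p" and gr: "g r \<le> p"
  shows "\<exists>n\<ge>1. 2*n+1 \<le> card Orb \<and> (S_on (<) a b g n \<or> S_on (>) a b g n)"
proof -
  have pI: "p \<in> {a..b}" and rI: "r \<in> {a..b}" using OI pO rO by auto
  have gOD: "g x \<in> Orb" if "x \<in> Orb" for x using gO that by auto
  obtain z where z: "p < z" "z < r" "g z = z" "z \<in> {a..b}"
    using gp gr pr by - (rule fixpoint_open[OF pr pI rI], auto)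
  have zO: "z \<notin> Orb" using gap z by force
  \<comment> \<open>By minimality \<open>g\<close> maps \<open>Orb\<close> onto itself, hence
    injectively. An exchange of sides would embed each half into the other, and
    \<open>card Orb\<close> would be even.\<close>
  have not_swap: False if swap: "\<And>x. x \<in> Orb \<Longrightarrow> x < z \<longleftrightarrow> z < g x"
  proof -
    let ?L = "{x\<in>Orb. x < z}" and ?R = "{x\<in>Orb. z < x}"
    have "g ` Orb = Orb" by (rule minimal) (use pO gO in auto)
    then have inj: "inj_on g Orb" using fin by (simp add: eq_card_imp_inj_on)
    have L: "g ` ?L \<subseteq> ?R" using swap gOD by auto
    have "g x < z" if "x \<in> Orb" "z < x" for x
      using swap[OF that(1)] that gOD[OF that(1)] zO by (metis linorder_neqE_linordered_idom order.asym)
    then have R: "g ` ?R \<subseteq> ?L" using gOD by auto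
    have "card ?L \<le> card ?R"
      by (rule card_inj_on_le[OF inj_on_subset[OF inj] L]) (use fin in auto)
    moreover have "card ?R \<le> card ?L"
      by (rule card_inj_on_le[OF inj_on_subset[OF inj] R]) (use fin in auto)
    moreover have "card Orb = card ?L + card ?R"
    proof -
      have "Orb = ?L \<union> ?R" using zO by (auto simp: not_less le_less)
      moreover have "card (?L \<union> ?R) = card ?L + card ?R"
        by (rule card_Un_disjoint) (use fin in auto)
      ultimately show ?thesis by simp
    qed
    ultimately show False using oddO by simp
  qed
  \<comment> \<open>The recursion has to spell out the sets later named \<open>A\<close>: orbit
    points from the current \<open>y j\<close> up to \<open>z\<close>, on the left at even stages
    and on the right at odd ones.\<close>
  define y where "y = rec_nat p (\<lambda>j w. if even j then Max (g ` {x\<in>Orb. w \<le> x \<and> x < z})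
    else Min (g ` {x\<in>Orb. z < x \<and> x \<le> w}))"
  define A where "A j = (if even j then {x\<in>Orb. y j \<le> x \<and> x < z} else {x\<in>Orb. z < x \<and> x \<le> y j})" for j
  \<comment> \<open>While \<open>sw\<close> holds, \<open>g\<close> carries \<open>A j\<close>
    across \<open>z\<close> into \<open>A (Suc j)\<close>; the construction is under control up to
    the first failure.\<close>
  define sw where "sw j \<longleftrightarrow> (\<forall>x\<in>A j. if even j then z < g x else g x < z)" for j
  have y0: "y 0 = p" by (simp add: y_def)
  have ySuc: "y (Suc j) = (if even j then Max (g ` A j) else Min (g ` A j))" for j
    by (simp add: y_def A_def)
  have finA: "finite (A j)" and AO: "A j \<subseteq> Orb" for j using fin by (auto simp: A_def)
  have sw_iff: "x < z \<longleftrightarrow> z < g x" if "sw j" "x \<in> A j" for x j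
    using that by (auto simp: sw_def A_def split: if_splits)
  have y_bound: "if even j then g x \<le> y (Suc j) else y (Suc j) \<le> g x" if "x \<in> A j" for x j
    using that finA by (simp add: ySuc)
  have y_attained: "\<exists>c\<in>A j. g c = y (Suc j)" if "A j \<noteq> {}" for j
  proof -
    have "y (Suc j) \<in> g ` A j" unfolding ySuc using that finA by simp
    then show ?thesis by auto
  qed
  have step: "y (Suc j) \<in> A (Suc j)" "g ` A j \<subseteq> A (Suc j)" if "y j \<in> A j" "sw j" for j
  proof -
    show sub: "g ` A j \<subseteq> A (Suc j)"
      using y_bound[of _ j] that(2) gOD AO by (fastforce simp: A_def[of "Suc j"] sw_def split: if_splits)
    show "y (Suc j) \<in> A (Suc j)" using y_attained[of j] that(1) sub by force
  qed
  have y0A: "y 0 \<in> A 0" using pO z by (simp add: A_def y0)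
  \<comment> \<open>Otherwise the union of all \<open>A j\<close> is invariant, hence all of
    \<open>Orb\<close>, and every orbit point would change sides.\<close>
  have "\<exists>j. \<not> sw j"
  proof (rule ccontr)
    assume "\<nexists>j. \<not> sw j"
    then have sw: "sw j" for j by blast
    have yA: "y j \<in> A j" for j by (induction j) (use y0A step(1) sw in auto)
    have "(\<Union>j. A j) = Orb"
    proof (rule minimal)
      show "g ` (\<Union>j. A j) \<subseteq> (\<Union>j. A j)" using step(2)[OF yA sw] by blast
    qed (use AO yA[of 0] in auto)
    then show False using not_swap sw_iff sw by (metis UN_E)
  qed
  define N where "N = (LEAST j. \<not> sw j)"
  have notN: "\<not> sw N" unfolding N_def using \<open>\<exists>j. \<not> sw j\<close> by (rule LeastI_ex)
  have sw: "sw j" if "j < N" for j using that not_less_Least unfolding N_def by blast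
  have yA: "y j \<in> A j" if "j \<le> N" for j
    using that by (induction j) (use y0A step(1) sw in auto)
  have gA: "g ` A j \<subseteq> A (Suc j)" if "j < N" for j using step(2) yA sw that by simp
  have A0: "A 0 = {p}" using pO z gap by (force simp: A_def y0)
  have "sw 0" unfolding sw_def using A0 gp z by simp
  then have N1: "1 \<le> N" using notN by (cases N) auto
  have y1: "y (Suc 0) = g p" by (simp add: ySuc A0)
  have A1: "A (Suc 0) = {x\<in>Orb. z < x \<and> x \<le> g p}" using y1 by (simp add: A_def)
  have rA1: "r \<in> A 1" using rO z gp by (simp add: A1)
  have A1_ge: "r \<le> c" if "c \<in> A 1" for c using that gap z by (force simp: A1)
  have A_mono: "A j \<subseteq> A (j+2)" if "j + 2 \<le> N" for j
    using that
  proof (induction j)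
    case 0
    have "y 2 \<in> A 2" using yA 0 by simp
    then have "y 2 \<le> p" using gap[of "y 2"] z by (force simp: A_def)
    then show ?case using pO z unfolding A0 by (simp add: A_def numeral_2_eq_2)
  next
    case (Suc j)
    then have sub: "A j \<subseteq> A (j+2)" by simp
    obtain c where c: "c \<in> A j" "g c = y (Suc j)"
      using y_attained[of j] yA[of j] Suc.prems by auto
    then show ?case using y_bound[OF subsetD[OF sub c(1)]]
      unfolding A_def[of "Suc j"] A_def[of "Suc j + 2"] by (auto split: if_splits)
  qed
  \<comment> \<open>If nothing is gained in two steps, \<open>A j\<close> and \<open>A (j+1)\<close>
    together are invariant and thus all of \<open>Orb\<close>; before stage \<open>N\<close> all
    their points change sides, which is impossible.\<close>
  have A_strict: "A j \<noteq> A (j+2)" if "j + 2 \<le> N" for j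
  proof
    assume eq: "A j = A (j+2)"
    have "A j \<union> A (j+1) = Orb"
    proof (rule minimal)
      show "g ` (A j \<union> A (j+1)) \<subseteq> A j \<union> A (j+1)"
        using gA[of j] gA[of "j+1"] eq that by auto
    qed (use AO yA[of j] that in auto)
    then show False using not_swap sw_iff[of j] sw_iff[of "j+1"] sw[of j] sw[of "j+1"] that
      by (metis Un_iff add_lessD1 less_add_one less_le_trans nat_add_left_cancel_less one_less_numeral_iff
        semiring_norm(76))
  qed
  have y_out: "if even j then y (j+2) < y j else y j < y (j+2)" if "j + 2 \<le> N" for j
  proof (rule ccontr)
    assume "\<not> ?thesis"
    then have "A (j+2) \<subseteq> A j" by (auto simp: A_def split: if_splits)
    then show False using A_mono[OF that] A_strict[OF that] by blast
  qed
  \<comment> \<open>The 3 counts \<open>p\<close>, \<open>r\<close> and \<open>g p\<close>; here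
    \<open>r < g p\<close> is essential. Each further stage adds at least one point. The resulting
    bound \<open>N + 2 \<le> card Orb\<close> is just what the odd case of \<open>N\<close>
    requires.\<close>
  have count: "i + 3 \<le> card (A i) + card (A (i+1))" if "i + 1 \<le> N" for i
    using that
  proof (induction i)
    case 0
    have "{r, g p} \<subseteq> A 1" using rA1 gOD pO gp z by (simp add: A1)
    then have "card {r, g p} \<le> card (A 1)" using finA card_mono by blast
    then show ?case using A0 gp by simp
  next
    case (Suc i)
    have "A i \<subset> A (i+2)" using A_mono[of i] A_strict[of i] Suc.prems by auto
    then have "card (A i) < card (A (i+2))" using finA psubset_card_mono by blast
    then show ?case using Suc by simp
  qed
  have cardN: "N + 2 \<le> card Orb"
  proof -
    have "A (N-1) \<inter> A N = {}" using N1 by (auto simp: A_def split: if_splits)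
    then have "card (A (N-1)) + card (A N) = card (A (N-1) \<union> A N)"
      using finA by (simp add: card_Un_disjoint)
    also have "\<dots> \<le> card Orb" using AO fin by (intro card_mono) auto
    finally show ?thesis using count[of "N-1"] N1 by simp
  qed
  have yI: "y j \<in> {a..b}" if "j \<le> N" for j using yA[OF that] AO OI by blast
  \<comment> \<open>The point \<open>c\<close> realising the outermost image \<open>y (j+1)\<close>
    cannot lie in \<open>A (j-2)\<close>, whose images reach only to \<open>y (j-1)\<close>. So
    \<open>c\<close> lies between \<open>y (j-2)\<close> and \<open>y j\<close>, and
    \<open>y (j-2)\<close> serves as the other witness.\<close>
  have outer: "covers g (closed_segment (y (j-2)) (y j)) (closed_segment (y (j-1)) (y (j+1)))"
    if j: "2 \<le> j" "j < N" for j
  proof -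
    define i where "i = j - 2"
    have i: "j = i + 2" using j by (simp add: i_def)
    obtain c where c: "c \<in> A j" "g c = y (j+1)"
      using y_attained[of j] yA[of j] j by auto
    have inner: "if even i then g w \<le> y (i+1) else y (i+1) \<le> g w" if "w \<in> A i" for w
      using y_bound[OF that] by simp
    have out: "if even i then y (i+1) < y (i+3) else y (i+3) < y (i+1)"
      using y_out[of "i+1"] i j by (simp add: numeral_3_eq_3 split: if_splits)
    have "c \<notin> A i" using inner[of c] out c(2) i by (auto split: if_splits simp: numeral_3_eq_3)
    then have c_seg: "c \<in> closed_segment (y i) (y (i+2))"
      using c(1) AO unfolding i by (auto simp: A_def closed_segment_eq_real_ivl split: if_splits)
    have yi: "y i \<in> A i" using yA i j by simp
    show ?thesis
      unfolding i
    proof (cases "even i")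
      case True
      show "covers g (closed_segment (y (i+2-2)) (y (i+2))) (closed_segment (y (i+2-1)) (y (i+2+1)))"
        by (rule covers_ivl[of "y i" _ _ c])
          (use c_seg c(2) inner[OF yi] out True i in \<open>auto simp: numeral_3_eq_3\<close>)
    next
      case False
      show "covers g (closed_segment (y (i+2-2)) (y (i+2))) (closed_segment (y (i+2-1)) (y (i+2+1)))"
        by (rule covers_ivl[of c _ _ "y i"])
          (use c_seg c(2) inner[OF yi] out False i in \<open>auto simp: numeral_3_eq_3\<close>)
    qed
  qed
  obtain w where w: "w \<in> A N" "if even N then g w \<le> p else r \<le> g w"
  proof -
    obtain w where w: "w \<in> A N" "\<not> (if even N then z < g w else g w < z)"
      using notN unfolding sw_def by blast
    have "g w \<in> Orb" using w(1) AO gOD by blast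
    then have "if even N then g w \<le> p else r \<le> g w" using gap[of "g w"] w(2) z by auto
    then show ?thesis using that w(1) by blast
  qed
  have w_seg: "w \<in> closed_segment (y (N-2)) (y N)" if "2 \<le> N"
  proof -
    have e: "even (N - 2) = even N" using that by simp
    have "sw (N-2)" using sw that by simp
    then have "w \<notin> A (N-2)" using w z unfolding sw_def e by (auto split: if_splits)
    then show ?thesis using w(1) AO e by (auto simp: A_def closed_segment_eq_real_ivl split: if_splits)
  qed
  have y_switch: "if even j then z < g (y j) else g (y j) < z" if "j < N" for j
    using sw[OF that] yA[of j] that unfolding sw_def by auto
  \<comment> \<open>The chain \<open>d\<close>, \<open>e\<close>, \<open>p\<close> joins the inside
    of the gap to the spiral. Entering it at \<open>d\<close> or already at \<open>z\<close> adjusts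
    the parity of the loop. The value \<open>e = r\<close> occurs when
    \<open>g r = p\<close>.\<close>
  obtain e where e: "z < e" "e \<le> r" "g e = p" "e \<in> {a..b}"
  proof (cases "g r = p")
    case True
    then show ?thesis using that[of r] z rI by simp
  next
    case False
    then obtain e where "z < e" "e < r" "g e = p" "e \<in> {a..b}"
      using gr z by - (rule ivt_open[OF z(2) z(4) rI, of p], auto)
    then show ?thesis using that[of e] by simp
  qed
  obtain d where d: "p < d" "d < z" "g d = e" "d \<in> {a..b}"
    using e gp z by - (rule ivt_open[OF z(1) pI z(4), of e], auto)
  have e_y1: "e < y 1" using e gp y1 by simp
  have second: "covers g (closed_segment e (y 1)) (closed_segment p (y 2))" if "2 \<le> N"
  proof -
    obtain c where c: "c \<in> A 1" "g c = y 2"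
      using y_attained[of 1] rA1 by (auto simp: numeral_2_eq_2)
    have "c \<in> closed_segment e (y 1)"
      using A1_ge[OF c(1)] c(1) e e_y1 by (simp add: A1 y1 closed_segment_eq_real_ivl)
    then show ?thesis using e(3) c(2) by (intro coversI[of e _ c]) auto
  qed
  show ?thesis
  proof (cases "even N")
    case True
    then obtain n where n: "N = 2*n" by blast
    \<comment> \<open>For even \<open>N\<close> the loop enters at \<open>d\<close> and has
      \<open>N + 1\<close> intervals; it closes because \<open>w\<close> stays left of
      \<open>z\<close> while \<open>y (N-2)\<close> is sent to the right.\<close>
    define Y where "Y j = (if j = 0 then d else if j = 1 then e else y (j-2))" for j
    have "S_on (<) a b g n"
    proof (rule S_on_of_spiral[where Y = Y])
      show "1 \<le> n" using n N1 by simp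
      show "Y j \<in> {a..b}" if "j \<le> 2*n+2" for j
        using that d(4) e(4) yI[of "j-2"] n unfolding Y_def by auto
      show "covers g (closed_segment (Y j) (Y (j+2))) (closed_segment (Y (j+1)) (Y (j+3)))"
        if "j < 2*n" for j
      proof -
        consider "j = 0" | "j = 1" | "2 \<le> j" by linarith
        then show ?thesis
        proof cases
          case 1
          then show ?thesis using d y0 y1
            by (intro coversI[of d _ p]) (auto simp: Y_def numeral_3_eq_3)
        next
          case 2
          then show ?thesis using second n that y0 by (auto simp: Y_def numeral_3_eq_3 numeral_2_eq_2)
        next
          case 3
          then have "j + 1 - 2 = j - 1" "j + 3 - 2 = j + 1" by auto
          then show ?thesis using outer[of j] that 3 n by (simp add: Y_def)
        qed
      qed
      have "2 \<le> N" using n N1 by presburger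
      then show "covers g (closed_segment (Y (2*n)) (Y (2*n+2))) (closed_segment (Y 0) (Y 2))"
        using w_seg w(2) y_switch[of "N-2"] True n y0 d z
        by (intro covers_ivl[of w _ _ "y (N-2)"]) (auto simp: Y_def)
      show "Y (2*j+2) \<le> Y (2*j)" if "j \<le> n" for j
      proof (cases "j = 0")
        case True
        then show ?thesis using y0 d by (simp add: Y_def)
      next
        case False
        then have "2*j-2+2 = 2*j" "even (2*j-2)" by auto
        then show ?thesis using y_out[of "2*j-2"] that n False by (simp add: Y_def)
      qed
      show "Y (2*j+1) \<le> Y (2*j+3)" if "j < n" for j
      proof (cases "j = 0")
        case True
        then show ?thesis using e_y1 by (simp add: Y_def)
      next
        case False
        then have "2*j-1+2 = 2*j+1" "odd (2*j-1)" "2*j+1-2 = 2*j-1" "2*j+3-2 = 2*j+1" by auto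
        then show ?thesis using y_out[of "2*j-1"] that n False by (simp add: Y_def)
      qed
    qed (use d e y0 z in \<open>auto simp: Y_def\<close>)
    then show ?thesis using cardN n N1 by (intro exI[of _ n]) auto
  next
    case False
    then obtain n' where n': "N = 2*n'+1" by (blast elim: oddE)
    define n where "n = n' + 1"
    have n: "2*n = N + 1" using n' n_def by simp
    \<comment> \<open>For odd \<open>N\<close> the extra start at \<open>z\<close> makes
      \<open>N + 2\<close> intervals. The returning point \<open>w\<close> now lies on the right,
      whence the reversed orientation.\<close>
    define Y where "Y j = (if j = 0 then z else if j = 1 then d else if j = 2 then e else y (j-3))" for j
    have "S_on (>) a b g n"
    proof (rule S_on_of_spiral_reversed[where Y = Y])
      show "1 \<le> n" using n_def by simp
      show "Y j \<in> {a..b}" if "j \<le> 2*n+2" for j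
        using that z(4) d(4) e(4) yI[of "j-3"] n unfolding Y_def by auto
      show "covers g (closed_segment (Y j) (Y (j+2))) (closed_segment (Y (j+1)) (Y (j+3)))"
        if "j < 2*n" for j
      proof -
        consider "j = 0" | "j = 1" | "j = 2" | "3 \<le> j" by linarith
        then show ?thesis
        proof cases
          case 1
          then show ?thesis using z e y0 d
            by (intro coversI[of z _ e])
              (auto simp: Y_def closed_segment_min_max)
        next
          case 2
          then show ?thesis using d y0 y1
            by (intro coversI[of d _ p]) (auto simp: Y_def numeral_3_eq_3)
        next
          case 3
          have "2 \<le> N" using n that 3 False by (cases "N = 1") auto
          then show ?thesis using second 3 y0 by (auto simp: Y_def numeral_3_eq_3 numeral_2_eq_2)
        next
          case 4
          then have "j - 3 = j - 1 - 2" "j + 2 - 3 = j - 1" "j + 1 - 3 = j - 1 - 1" "j + 3 - 3 = j - 1 + 1"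
            by auto
          then show ?thesis using outer[of "j-1"] that 4 n by (simp add: Y_def)
        qed
      qed
      show "covers g (closed_segment (Y (2*n)) (Y (2*n+2))) (closed_segment (Y 0) (Y 2))"
      \<comment> \<open>With \<open>N = 1\<close> no \<open>y (N-2)\<close> is available; its role
        is taken by \<open>e\<close>, which goes to \<open>p\<close> left of
        \<open>z\<close>.\<close>
      proof (cases "N = 1")
        case True
        have "w \<in> closed_segment e (y 1)"
          using w(1) A1_ge[of w] True e e_y1 by (simp add: A1 y1 closed_segment_eq_real_ivl)
        then show ?thesis using True n e w(2) z y0
          by (intro covers_ivl[of e _ _ w]) (auto simp: Y_def)
      next
        case False
        then have "3 \<le> N" using n' by presburger
        moreover from this have "N + 1 - 3 = N - 2" "N + 1 + 2 - 3 = N" by auto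
        ultimately show ?thesis
          using w_seg w(2) y_switch[of "N-2"] \<open>odd N\<close> n e z
          by (intro covers_ivl[of "y (N-2)" _ _ w]) (auto simp: Y_def)
      qed
      show "Y (2*j) \<le> Y (2*j+2)" if "j \<le> n" for j
      proof -
        consider "j = 0" | "j = 1" | "2 \<le> j" by linarith
        then show ?thesis
        proof cases
          case 3
          then have "2*j-3+2 = 2*j-1" "odd (2*j-3)" "2*j+2-3 = 2*j-1" by auto
          moreover have "2*j-3+2 \<le> N" using that n 3 by auto
          ultimately show ?thesis using y_out[of "2*j-3"] 3 by (simp add: Y_def)
        qed (use e e_y1 in \<open>auto simp: Y_def\<close>)
      qed
      show "Y (2*j+3) \<le> Y (2*j+1)" if "j < n" for j
      proof (cases "j = 0")
        case True
        then show ?thesis using d y0 by (simp add: Y_def)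
      next
        case False
        then have "2*j-2+2 = 2*j" "even (2*j-2)" "2*j+1-3 = 2*j-2" "2*j+3-3 = 2*j" by auto
        then show ?thesis using y_out[of "2*j-2"] that n False by (simp add: Y_def)
      qed
    qed (use d e in \<open>auto simp: Y_def\<close>)
    moreover have "2*n+1 \<le> card Orb"
    proof -
      have "N + 2 \<noteq> card Orb + 1" "odd (N+2)" using cardN False by auto
      then show ?thesis using cardN n by simp
    qed
    ultimately show ?thesis using n_def by (intro exI[of _ n]) auto
  qed
qed

end

lemma S_on_reflect': "S_on (>) (- b) (- a) (reflect g) n \<longleftrightarrow> S_on (<) a b g n"
  by (simp add: S_on_reflect)

context interval_map
begin

text \<open>Let \<open>p\<close> be the last orbit point moved to the right and \<open>r\<close> its
  successor in the orbit. Both images cannot be exactly the other point, or there would be a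
  2-cycle. If \<open>g p\<close> overshoots \<open>r\<close>, the auxiliary lemma applies; otherwise
  \<open>g r\<close> overshoots \<open>p\<close>, and reflection exchanges the two roles.\<close>

lemma stefan_of_odd_orbit:
  assumes fin: "finite Orb" and OI: "Orb \<subseteq> {a..b}" and gO: "g ` Orb \<subseteq> Orb"
    and minimal: "\<And>C. C \<subseteq> Orb \<Longrightarrow> C \<noteq> {} \<Longrightarrow> g ` C \<subseteq> C \<Longrightarrow> C = Orb"
    and oddO: "odd (card Orb)" and card: "3 \<le> card Orb"
  shows "\<exists>n\<ge>1. 2*n+1 \<le> card Orb \<and> (S_on (<) a b g n \<or> S_on (>) a b g n)"
proof -
  have ne: "Orb \<noteq> {}" using card by auto
  have gOD: "g x \<in> Orb" if "x \<in> Orb" for x using gO that by auto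
  have nofix: "g x \<noteq> x" if "x \<in> Orb" for x
  proof
    assume "g x = x"
    then have "{x} = Orb" using that by (intro minimal) auto
    then have "card Orb = card {x}" by simp
    then show False using card by simp
  qed
  define U where "U = {x\<in>Orb. x < g x}"
  have finU: "finite U" using fin by (simp add: U_def)
  have "Min Orb \<in> Orb" using fin ne by simp
  then have "Min Orb < g (Min Orb)"
    using nofix[of "Min Orb"] Min_le[OF fin gOD, of "Min Orb"] by simp
  then have U: "Min Orb \<in> U" using \<open>Min Orb \<in> Orb\<close> by (simp add: U_def)
  define p where "p = Max U"
  have "p \<in> U" unfolding p_def using U finU by (intro Max_in) auto
  then have p: "p \<in> Orb" "p < g p" by (auto simp: U_def)
  define V where "V = {x\<in>Orb. p < x}"
  have V: "g p \<in> V" "finite V" using p gOD fin by (auto simp: V_def)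
  define r where "r = Min V"
  have "r \<in> V" unfolding r_def using V by (intro Min_in) auto
  then have r: "r \<in> Orb" "p < r" by (auto simp: V_def)
  have gap: "x \<le> p \<or> r \<le> x" if "x \<in> Orb" for x
    using Min_le[OF V(2), of x] that by (cases "p < x") (simp_all add: r_def V_def)
  have "r \<notin> U" using Max_ge[OF finU, of r] r(2) by (auto simp: p_def)
  then have "g r < r" using r(1) nofix[OF r(1)] by (auto simp: U_def)
  then have gr: "g r \<le> p" using gap[OF gOD[OF r(1)]] by simp
  have gp: "r \<le> g p" using gap[OF gOD[OF p(1)]] p(2) by simp
  show ?thesis
  proof (cases "g p = r")
    case False
    then show ?thesis
      using stefan_of_odd_orbit_aux[OF fin OI gO minimal oddO p(1) r(1,2) gap _ gr] gp by simp
  next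
    case True
    have "g r \<noteq> p"
    proof
      assume "g r = p"
      then have "{p, r} = Orb" using True p r by (intro minimal) auto
      then have "card Orb = card {p, r}" by simp
      also have "\<dots> \<le> 2" by (simp add: card_insert_if)
      finally show False using card by simp
    qed
    interpret R: interval_map "- b" "- a" "reflect g"
      by (rule interval_map_reflect) unfold_locales
    have card_eq: "card (uminus ` Orb) = card Orb" by (simp add: card_image)
    have "\<exists>n\<ge>1. 2*n+1 \<le> card (uminus ` Orb) \<and>
      (S_on (<) (- b) (- a) (reflect g) n \<or> S_on (>) (- b) (- a) (reflect g) n)"
    proof (rule R.stefan_of_odd_orbit_aux[of _ "- r" "- p"])
      show "C = uminus ` Orb" if C: "C \<subseteq> uminus ` Orb" "C \<noteq> {}" "reflect g ` C \<subseteq> C" for C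
      proof -
        have "uminus ` C = Orb"
        proof (rule minimal)
          have "- g (- x) \<in> C" if "x \<in> C" for x using C(3) that by (auto simp: reflect_def)
          then show "g ` uminus ` C \<subseteq> uminus ` C" by force
        qed (use C in auto)
        then have "uminus ` uminus ` C = uminus ` Orb" by simp
        then show ?thesis by (simp add: image_image)
      qed
      show "x \<le> - r \<or> - p \<le> x" if "x \<in> uminus ` Orb" for x
        using that gap by force
    qed (use fin OI gO oddO p r gp gr card_eq \<open>g r \<noteq> p\<close> in \<open>auto simp: reflect_def\<close>)
    then show ?thesis unfolding card_eq S_on_reflect' S_on_reflect[symmetric] by blast
  qed
qed

text \<open>The orbit of a point of period \<open>q\<close> has exactly \<open>q\<close> elements
  and, being a single cycle, no proper nonempty invariant subset.\<close>

lemma odd_period_imp_stefan: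
  assumes x: "x \<in> {a..b}" and per: "per_pt g q x" and q: "odd q" "3 \<le> q"
  shows "\<exists>n\<ge>1. 2*n+1 \<le> q \<and> (S_on (<) a b g n \<or> S_on (>) a b g n)"
proof -
  have cyc: "(g ^^ q) x = x" and ne: "\<And>j. 0 < j \<Longrightarrow> j < q \<Longrightarrow> (g ^^ j) x \<noteq> x"
    using per by (auto simp: per_pt_def)
  define Orb where "Orb = (\<lambda>j. (g ^^ j) x) ` {..<q}"
  have neq: "(g ^^ i) x \<noteq> (g ^^ j) x" if "i < j" "j < q" for i j
  proof
    assume eq: "(g ^^ i) x = (g ^^ j) x"
    have "(g ^^ (q - j + i)) x = (g ^^ (q - j)) ((g ^^ j) x)" by (simp add: funpow_add eq)
    also have "\<dots> = (g ^^ (q - j + j)) x" by (simp only: funpow_add comp_apply)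
    also have "\<dots> = x" using cyc that by simp
    finally have "(g ^^ (q - j + i)) x = x" .
    moreover have "0 < q - j + i" "q - j + i < q" using that by auto
    note ne[OF this]
    ultimately show False by (rule notE[rotated])
  qed
  have "inj_on (\<lambda>j. (g ^^ j) x) {..<q}"
  proof (rule linorder_inj_onI)
    show "(g ^^ i) x \<noteq> (g ^^ j) x" if "i < j" "i \<in> {..<q}" "j \<in> {..<q}" for i j
      using neq[OF that(1)] that(3) by blast
  qed auto
  then have card: "card Orb = q" unfolding Orb_def by (simp add: card_image)
  have mem: "(g ^^ j) x \<in> Orb" for j
  proof -
    have "(g ^^ j) x = (g ^^ (j mod q + q * (j div q))) x" by simp
    also have "\<dots> = (g ^^ (j mod q)) x"
      unfolding funpow_add comp_apply funpow_cycle[OF cyc] ..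
    finally show ?thesis unfolding Orb_def using q by auto
  qed
  have "C = Orb" if C: "C \<subseteq> Orb" "C \<noteq> {}" "g ` C \<subseteq> C" for C
  proof -
    obtain j where j: "j < q" "(g ^^ j) x \<in> C" using C unfolding Orb_def by blast
    have fwd: "(g ^^ i) w \<in> C" if "w \<in> C" for i w
      using that C(3) by (induction i) auto
    have "(g ^^ i) x \<in> C" for i
    proof -
      have "(g ^^ (i + (q - j))) ((g ^^ j) x) = (g ^^ (i + (q - j + j))) x"
        by (simp only: funpow_add comp_apply)
      also have "\<dots> = (g ^^ i) x" using j(1) cyc by (simp add: funpow_add)
      finally show ?thesis using fwd[OF j(2)] by metis
    qed
    then show ?thesis using C(1) unfolding Orb_def by blast
  qed
  moreover have "g ` Orb \<subseteq> Orb"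
    using mem[of "Suc j" for j] by (auto simp: Orb_def)
  moreover have "Orb \<subseteq> {a..b}" unfolding Orb_def using iter_in[OF x] by blast
  moreover have "finite Orb" by (simp add: Orb_def)
  ultimately show ?thesis using stefan_of_odd_orbit[of Orb] card q by simp
qed

lemma S_on_mono:
  assumes "1 \<le> n" "n \<le> n'" "S_on (<) a b g n \<or> S_on (>) a b g n"
  shows "S_on (<) a b g n' \<or> S_on (>) a b g n'"
  using assms(2)
proof (induction n' rule: dec_induct)
  case base
  show ?case by fact
next
  case (step k)
  interpret R: interval_map "- b" "- a" "reflect g"
    by (rule interval_map_reflect) unfold_locales
  show ?case
    using step S_on_Suc[of k] R.S_on_Suc[of k] assms(1) unfolding S_on_reflect by auto
qed

lemma stefan_imp_period:
  assumes "S_on (<) a b g n \<or> S_on (>) a b g n" "1 \<le> n" "2*n+1 \<le> N"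
  shows "\<exists>y\<in>{a..b}. per_pt g N y"
proof -
  interpret R: interval_map "- b" "- a" "reflect g"
    by (rule interval_map_reflect) unfold_locales
  have "\<exists>y\<in>{a..b}. per_pt g N y" if "S_on (>) a b g n"
    using R.S_on_imp_period[of n N] that assms(2,3)
    unfolding S_on_reflect per_pt_reflect by (metis bex_reflect)
  then show ?thesis using S_on_imp_period assms by blast
qed

lemma odd_period_imp_S_on:
  assumes "x \<in> {a..b}" "per_pt g (2*n+1) x" "1 \<le> n"
  shows "S_on (<) a b g n \<or> S_on (>) a b g n"
proof -
  obtain m where "1 \<le> m" "2*m+1 \<le> 2*n+1" "S_on (<) a b g m \<or> S_on (>) a b g m"
    using odd_period_imp_stefan[OF assms(1,2)] assms(3) by auto
  then show ?thesis using S_on_mono[of m n] by simp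
qed

end

section \<open>Periods of iterates\<close>

lemma per_pt_funpow:
  assumes "per_pt f (k * q) x" "0 < k"
  shows "per_pt (f ^^ k) q x"
  using assms by (auto simp: per_pt_def funpow_mult)

text \<open>A return of \<open>f\<close> at time \<open>j\<close> is also one at time
  \<open>2*j\<close>. For odd \<open>j < 2*M\<close>, comparing \<open>2*j\<close> with
  \<open>2*M\<close> contradicts minimality unless \<open>j = M\<close>; even \<open>j\<close> is
  excluded directly.\<close>

lemma per_pt_square:
  assumes "per_pt (f ^^ 2) M x"
  shows "per_pt f (2*M) x \<or> odd M \<and> per_pt f M x"
proof -
  have cyc: "(f ^^ (2*M)) x = x" and ne: "\<And>j. 0 < j \<Longrightarrow> j < M \<Longrightarrow> (f ^^ (2*j)) x \<noteq> x"
    using assms by (auto simp: per_pt_def funpow_mult)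
  have double: "(f ^^ (2*j)) x = x" if "(f ^^ j) x = x" for j
    using funpow_cycle[OF that, of 2] by (simp add: mult.commute)
  have only: "j = M \<and> odd M" if j: "0 < j" "j < 2*M" "(f ^^ j) x = x" for j
  proof (cases "even j")
    case True
    then obtain i where "j = 2*i" by blast
    then show ?thesis using ne[of i] j by simp
  next
    case False
    have "\<not> j < M" using ne[of j] double[OF j(3)] j(1) by blast
    moreover have "\<not> M < j"
    proof
      assume "M < j"
      then have "2*(j-M) + 2*M = 2*j" by simp
      then have "(f ^^ (2*(j-M))) ((f ^^ (2*M)) x) = x"
        using double[OF j(3)] by (metis comp_apply funpow_add)
      then show False using ne[of "j-M"] cyc \<open>M < j\<close> j(2) by simp
    qed
    ultimately show ?thesis using False by simp
  qed
  show ?thesis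
  proof (cases "per_pt f (2*M) x")
    case False
    then obtain j where j: "0 < j" "j < 2*M" "(f ^^ j) x = x"
      using cyc by (auto simp: per_pt_def)
    then have "odd M" "(f ^^ M) x = x" using only by auto
    moreover have "(f ^^ i) x \<noteq> x" if "0 < i" "i < M" for i
      using ne[OF that] double[of i] by blast
    ultimately show ?thesis unfolding per_pt_def by blast
  qed simp
qed

text \<open>The period of the given point may drop by a power of 2; an odd period of a lower iterate
  is then doubled via a Stefan cycle.\<close>

lemma period_of_funpow_power2:
  assumes "interval_map a b f" "x \<in> {a..b}" "per_pt (f ^^ (2^i)) (2*n+1) x" "1 \<le> n"
  shows "\<exists>y\<in>{a..b}. per_pt f (2^i * (2*n+1)) y"
  using assms
proof (induction i arbitrary: f x)
  case 0
  then show ?case by auto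
next
  case (Suc i)
  interpret interval_map a b f by fact
  \<comment> \<open>The induction hypothesis is used for \<open>f ^^ 2\<close>, so that a single
    squaring remains to be undone.\<close>
  have "per_pt ((f ^^ 2) ^^ (2^i)) (2*n+1) x" using Suc.prems(3) by (simp add: funpow_mult)
  then obtain y where y: "y \<in> {a..b}" "per_pt (f ^^ 2) (2^i * (2*n+1)) y"
    using Suc.IH[OF interval_map_iter Suc.prems(2) _ Suc.prems(4)] by blast
  from per_pt_square[OF y(2)] show ?case
  proof
    assume "per_pt f (2 * (2^i * (2*n+1))) y"
    then show ?thesis using y(1) by (auto simp: mult.assoc)
  next
    assume *: "odd (2^i * (2*n+1)) \<and> per_pt f (2^i * (2*n+1)) y"
    \<comment> \<open>The product is odd only for \<open>i = 0\<close>. A Stefan cycle of length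
      \<open>2*n+1\<close> forces every larger period, in particular the doubled one.\<close>
    then have "i = 0" by (cases i) auto
    with * have "per_pt f (2*n+1) y" by simp
    from odd_period_imp_S_on[OF y(1) this Suc.prems(4)]
    have "\<exists>w\<in>{a..b}. per_pt f (2*(2*n+1)) w"
      by (rule stefan_imp_period) (use Suc.prems(4) in auto)
    then show ?thesis using \<open>i = 0\<close> by simp
  qed
qed

section \<open>From Stefan cycles to L-type cycles of the square\<close>

lemma reflect_power: "reflect g ^^ j = reflect (g ^^ j)"
  by (simp add: fun_eq_iff reflect_funpow reflect_def)

text \<open>Since the period is odd, \<open>g ^^ 2\<close> runs through the even times 0, 2, ...,
  \<open>2*n\<close>, moving left, and then wraps around to the odd times 1, 3, ...,
  \<open>2*n-1\<close>, moving right.\<close>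

lemma S_on_imp_Lmn_on_square:
  assumes "S_on (<) a b g n" "interval_map a b g" "1 \<le> n"
  shows "Lmn_on (>) a b (g ^^ 2) n (n+1)"
proof -
  interpret interval_map a b g by fact
  obtain x where x: "x \<in> {a..b}" "per_pt g (2*n+1) x" "S_order (<) (\<lambda>j. (g ^^ j) x) n"
    using assms(1) unfolding S_on_def by blast
  have cyc: "(g ^^ (2*n+1)) x = x" using x(2) by (simp add: per_pt_def)
  have wrap: "(g ^^ (j + (2*n+1))) x = (g ^^ j) x" for j
    by (metis comp_apply cyc funpow_add)
  show ?thesis
  proof (rule Lmn_onI[OF x(1)])
    have "2 * (n + (n+1)) = (2*n+1)*2" by simp
    then show "((g ^^ 2) ^^ (n + (n+1))) x = x"
      using funpow_cycle[OF cyc, of 2] unfolding funpow_mult by metis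
    show "Lmn_order (>) (\<lambda>j. ((g ^^ 2) ^^ j) x) n (n+1)"
      unfolding Lmn_order_def funpow_mult
    proof (intro conjI allI impI)
      show "(g ^^ (2*(j+1))) x < (g ^^ (2*j)) x" if "j + 1 < n + 1" for j
        using x(3) that by (simp add: S_order_def)
      have "2*(n+1) = 1 + (2*n+1)" by simp
      then show "(g ^^ (2*0)) x < (g ^^ (2*(n+1))) x"
        using x(3) wrap[of 1] by (metis S_order_def mult_0_right)
      show "(g ^^ (2*j)) x < (g ^^ (2*(j+1))) x" if j: "n + 1 \<le> j \<and> j + 1 < n + (n+1)" for j
      proof -
        define i where "i = j - n - 1"
        have "2*j = (2*i+1) + (2*n+1)" "2*(j+1) = (2*i+3) + (2*n+1)" "i + 1 < n"
          using j by (auto simp: i_def)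
        then show ?thesis using x(3) wrap unfolding S_order_def by metis
      qed
    qed
  qed simp
qed

text \<open>The 3-cycle has too few points to be read as such a cycle of \<open>g ^^ 2\<close>, so a
  loop of four intervals is built with preimages \<open>d\<close> and \<open>e\<close> on either
  side of the fixed point.\<close>

lemma S_on_1_imp_Lmn_on_square:
  assumes "S_on (<) a b g 1" "interval_map a b g"
  shows "Lmn_on (<) a b (g ^^ 2) 2 2"
proof -
  interpret interval_map a b g by fact
  interpret H: interval_map a b "g ^^ 2" by (rule interval_map_iter)
  obtain x0 where x0: "x0 \<in> {a..b}" "per_pt g 3 x0" "S_order (<) (\<lambda>j. (g ^^ j) x0) 1"
    using assms(1) unfolding S_on_def by auto
  define x1 x2 where "x1 = g x0" and "x2 = g x1"
  have g2: "g x2 = x0" using x0(2) by (simp add: per_pt_def x1_def x2_def numeral_3_eq_3)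
  have "(g ^^ 2) x0 = x2" by (simp add: x1_def x2_def numeral_2_eq_2)
  moreover have "(g ^^ 0) x0 < (g ^^ 1) x0" using x0(3) unfolding S_order_def by blast
  ultimately have ord: "x2 < x0" "x0 < x1"
    using S_order_less(1)[OF x0(3), of 0 1] by (simp_all add: x1_def)
  have xin: "x1 \<in> {a..b}" "x2 \<in> {a..b}"
    using iter_in[OF x0(1), of 1] iter_in[OF x0(1), of 2] by (simp_all add: x1_def x2_def numeral_2_eq_2)
  obtain z where z: "x0 < z" "z < x1" "g z = z" "z \<in> {a..b}"
    using ord by - (rule fixpoint_open[OF ord(2) x0(1) xin(1)], auto simp: x1_def[symmetric] x2_def[symmetric])
  obtain d where d: "z < d" "d < x1" "g d = x0" "d \<in> {a..b}"
    using ord z by - (rule ivt_open[OF z(2) z(4) xin(1), of x0], auto simp: x2_def[symmetric])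
  obtain e where e: "x0 < e" "e < z" "g e = d" "e \<in> {a..b}"
    using d z by - (rule ivt_open[OF z(1) x0(1) z(4), of d], auto simp: x1_def[symmetric])
  have h: "(g ^^ 2) z = z" "(g ^^ 2) d = x1" "(g ^^ 2) x1 = x0" "(g ^^ 2) e = x0" "(g ^^ 2) x0 = x2"
    "(g ^^ 2) x2 = x1"
    using z d e g2 by (simp_all add: numeral_2_eq_2 x1_def x2_def)
  \<comment> \<open>The points are ordered \<open>x2 < x0 < e < z < d < x1\<close>. Two intervals
    lie on each side of the gap from \<open>e\<close> to \<open>z\<close>, and the values in
    \<open>h\<close> give the four coverings.\<close>
  define u v where "u j = (if j = 0 then z else if j = 1 then d else if j = 2 then x0 else x2)"
    and "v j = (if j = 0 then d else if j = 1 then x1 else if j = 2 then e else x0)" for j :: nat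
  show ?thesis
  proof (rule H.Lmn_on_of_loop[where c = u and d = v])
    show "u j \<in> {a..b} \<and> v j \<in> {a..b} \<and> u j \<le> v j" for j
      unfolding u_def v_def using x0(1) xin z d e ord by auto
    show "covers (g ^^ 2) (closed_segment (u j) (v j)) (closed_segment (u (Suc j)) (v (Suc j)))"
      if j: "Suc j < 2 + 2" for j
    proof -
      consider "j = 0" | "j = 1" | "j = 2" using j by linarith
      then show ?thesis
      proof cases
        case 1
        then show ?thesis using h z d
          by (intro coversI[of z _ d]) (auto simp: u_def v_def closed_segment_min_max)
      next
        case 2
        then show ?thesis using h e z d ord
          by (intro coversI[of d _ x1]) (auto simp: u_def v_def closed_segment_min_max)
      next
        case 3
        then show ?thesis using h by (intro coversI[of x0 _ e]) (auto simp: u_def v_def)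
      qed
    qed
    show "covers (g ^^ 2) (closed_segment (u (2+2-1)) (v (2+2-1))) (closed_segment (u 0) (v 0))"
      by (rule coversI[of x2 _ x0])
        (use h d z ord in \<open>auto simp: u_def v_def closed_segment_min_max\<close>)
  qed (use e z in \<open>auto simp: u_def v_def\<close>)
qed

section \<open>The implications, with both orientations combined\<close>

theorem theorem3:
  fixes f :: "real \<Rightarrow> real" and a b :: real and m n k i p :: nat
  assumes "a < b" and "continuous_on {a..b} f" and "f ` {a..b} \<subseteq> {a..b}"
    and "m \<ge> 2" and "n \<ge> 2" and "k \<ge> 1" and "p \<ge> 1"
  shows "(Lmn_prop f a b k m n \<longrightarrow> Lmn_prop f a b k m (n+1))
       \<and> (Lmn_prop f a b k m n \<longrightarrow> Lmn_prop f a b k (m+1) n)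
       \<and> (Lmn_prop f a b k m n \<longrightarrow> Lminf_prop f a b k m)
       \<and> (Lminf_prop f a b k m \<longrightarrow> Lminf_prop f a b k (m+1))
       \<and> (Lminf_prop f a b k (m+1) \<longrightarrow> Linfinf_prop f a b k)
       \<and> (Linfinf_prop f a b k \<longrightarrow> Linf_prop f a b k)
       \<and> (S_prop f a b (2^i) 1 \<longrightarrow> Lmn_prop f a b (2^(i+1)) 2 2)
       \<and> (S_prop f a b (2^i) n \<longrightarrow> Lmn_prop f a b (2^(i+1)) n (n+1))
       \<and> (S_prop f a b (2^i) p \<longrightarrow> P_prop f a b (2^i * (2*p+3)))
       \<and> (P_prop f a b (2^i * (2*p+3)) \<longrightarrow> S_prop f a b (2^i) (p+1))"
proof -
  interpret F: interval_map a b f using assms(2,3) by unfold_locales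
  interpret G: interval_map a b "f ^^ k" by (rule F.interval_map_iter)
  interpret GR: interval_map "- b" "- a" "reflect (f ^^ k)"
    by (rule interval_map_reflect) (rule F.interval_map_iter)
  interpret H: interval_map a b "f ^^ (2^i)" by (rule F.interval_map_iter)
  interpret HR: interval_map "- b" "- a" "reflect (f ^^ (2^i))"
    by (rule interval_map_reflect) (rule F.interval_map_iter)
  note GI = G.interval_map_axioms and GRI = GR.interval_map_axioms
  have sq: "f ^^ (2^(i+1)) = (f ^^ (2^i)) ^^ 2" by (simp add: funpow_mult mult.commute)
  \<comment> \<open>Restarting a cycle beyond the gap exchanges \<open>m\<close> and
    \<open>n\<close> and reverses the orientation. The property admits both orientations, so it is
    symmetric, and enlarging \<open>m\<close> reduces to enlarging \<open>n\<close>.\<close>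
  have swap: "Lmn_prop f a b k m n \<longleftrightarrow> Lmn_prop f a b k n m" if "0 < m" "0 < n" for m n
  proof -
    have "Lmn_prop f a b k n m" if L: "Lmn_prop f a b k m n" and mn: "0 < m" "0 < n" for m n
    proof -
      have "Lmn_on (<) a b (f ^^ k) n m" if "Lmn_on (>) a b (f ^^ k) m n"
        using Lmn_on_swap[OF _ GRI mn] that unfolding Lmn_on_reflect by simp
      then show ?thesis using L Lmn_on_swap[OF _ GI mn] unfolding prop_iff_on by blast
    qed
    then show ?thesis using that by blast
  qed
  have 1: "Lmn_prop f a b k m (n+1)" if "Lmn_prop f a b k m n" "2 \<le> m" "2 \<le> n" for m n
    using that G.Lmn_on_Suc_right[of m n] GR.Lmn_on_Suc_right[of m n]
    unfolding prop_iff_on Lmn_on_reflect by blast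
  have 2: "Lmn_prop f a b k (m+1) n" if "Lmn_prop f a b k m n"
    using 1[of n m] swap[of m n] swap[of "m+1" n] that assms(4,5) by simp
  have 3: "Lminf_prop f a b k m" if "Lmn_prop f a b k m n"
    using that G.Lmn_on_imp_Lminf_on[of m n] GR.Lmn_on_imp_Lminf_on[of m n] assms(4,5)
    unfolding prop_iff_on Lmn_on_reflect Lminf_on_reflect by blast
  have 4: "Lminf_prop f a b k (m+1)" if "Lminf_prop f a b k m"
    using that G.Lminf_on_Suc[of m] GR.Lminf_on_Suc[of m] assms(4)
    unfolding prop_iff_on Lminf_on_reflect by blast
  have 5: "Linfinf_prop f a b k" if "Lminf_prop f a b k (m+1)"
    using that G.Lminf_on_imp_Linfinf_on[of "m+1"] GR.Lminf_on_imp_Linfinf_on[of "m+1"] assms(4)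
    unfolding prop_iff_on Lminf_on_reflect Linfinf_on_reflect by auto
  have 7: "Lmn_prop f a b (2^(i+1)) 2 2" if "S_prop f a b (2^i) 1"
    using that S_on_1_imp_Lmn_on_square[OF _ H.interval_map_axioms]
      S_on_1_imp_Lmn_on_square[OF _ HR.interval_map_axioms]
    unfolding prop_iff_on sq S_on_reflect Lmn_on_reflect reflect_power by blast
  have 8: "Lmn_prop f a b (2^(i+1)) n (n+1)" if "S_prop f a b (2^i) n"
  proof -
    have "Lmn_on (<) a b ((f ^^ (2^i)) ^^ 2) n (n+1)" if "S_on (>) a b (f ^^ (2^i)) n"
      using S_on_imp_Lmn_on_square[OF _ HR.interval_map_axioms, of n] that assms(5)
      unfolding S_on_reflect Lmn_on_reflect reflect_power by simp
    then show ?thesis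
      using that S_on_imp_Lmn_on_square[OF _ H.interval_map_axioms, of n] assms(5)
      unfolding prop_iff_on sq by auto
  qed
  have 9: "P_prop f a b (2^i * (2*p+3))" if "S_prop f a b (2^i) p"
  proof -
    have S: "S_on (<) a b (f ^^ (2^i)) p \<or> S_on (>) a b (f ^^ (2^i)) p"
      using that unfolding prop_iff_on .
    have "2*p+1 \<le> 2*(p+1)+1" by simp
    then obtain x where "x \<in> {a..b}" "per_pt (f ^^ (2^i)) (2*(p+1)+1) x"
      using H.stefan_imp_period[OF S assms(7)] by blast
    from period_of_funpow_power2[OF F.interval_map_axioms this]
    have "P_prop f a b (2^i * (2*(p+1)+1))" unfolding P_prop_def by simp
    moreover have "2*(p+1)+1 = 2*p+3" by simp
    ultimately show ?thesis by (simp only:)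
  qed
  have 10: "S_prop f a b (2^i) (p+1)" if P: "P_prop f a b (2^i * (2*p+3))"
  proof -
    obtain x where x: "x \<in> {a..b}" "per_pt f (2^i * (2*p+3)) x"
      using P unfolding P_prop_def by blast
    have "2*p+3 = 2*(p+1)+1" by simp
    moreover have "per_pt (f ^^ (2^i)) (2*p+3) x" by (rule per_pt_funpow[OF x(2)]) simp
    ultimately have "per_pt (f ^^ (2^i)) (2*(p+1)+1) x" by (simp only:)
    from H.odd_period_imp_S_on[OF x(1) this] show ?thesis unfolding prop_iff_on by simp
  qed
  show ?thesis
    using 1 2 3 4 5 Linfinf_prop_imp_Linf_prop 7 8 9 10 assms(4,5) by blast
qed

end
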